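(* For every double coset $\mathfrak g\in\mathbf K\setminus\mathbf G/\mathbf K$ and all self-dual submodules $Q,T\subset\mathcal H$, one has $\chi_{\mathfrak g}(Q,T)\in\overline{\mathrm{Naz}}(\mathcal V,\mathcal V)$, i.e. $\chi_{\mathfrak g}(Q,T)$ is a self-dual submodule of $\mathcal V\oplus\mathcal V$ with respect to the form $B^\ominus(u\oplus v,u'\oplus v')=B_{\mathcal V}(u,u')-B_{\mathcal V}(v,v')$.
   Context: Let $p$ be a prime, $\alpha\ge 0$ and $k\ge 1$ integers. $\mathbf G=\mathrm{GL}(\alpha+k\infty,\mathbb Q_p)$ is the group of finitary ($g-1$ has finitely many nonzero entries) invertible block matrices over $\mathbb Q_p$ of size $\alpha+\infty+\dots+\infty$ ($k$ copies of $\infty=\mathbb N$). It is the union of the subgroups $\mathrm{GL}(\alpha+km,\mathbb Q_p)$, where in each of the $k$ infinite blocks only the first $m$ coordinates are involved. $\mathrm O(\infty,\mathbb Z_p)$ is the group of finitary infinite orthogonal matrices with entries in $\mathbb Z_p$, embedded in $\mathbf G$ by $\mathfrak I(u)=\mathrm{diag}(1_\alpha,u,\dots,u)$; its image is $\mathbf K$. A submodule means a $\mathbb Z_p$-submodule of a finite-dimensional $\mathbb Q_p$-space. If $V$ carries a nondegenerate skew-symmetric bilinear form $B$, a submodule $R\subset V$ is isotropic if $B(v,w)\in\mathbb Z_p$ for all $v,w\in R$, and self-dual if it is maximal isotropic (equivalently, $R=\{w: B(v,w)\in\mathbb Z_p\ \forall v\in R\}$). $\mathcal V=\mathbb Q_p^\alpha\oplus\mathbb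 Q_p^\alpha$ and $\mathcal H=\mathbb Q_p^k\oplus\mathbb Q_p^k$ carry the standard skew-symmetric forms $B_{\mathcal V},B_{\mathcal H}$ with matrix $\begin{pmatrix}0&1\\ -1&0\end{pmatrix}$. A vector $x=(x_1^+,\dots,x_k^+,x_1^-,\dots,x_k^-)$ with $x_j^\pm\in\mathbb Q_p^m$ is regarded as an element of $\mathcal H\otimes\mathbb Q_p^m$; for a submodule $Q\subset\mathcal H$, $Q\otimes\mathbb Z_p^m$ is the direct sum of $m$ copies of $Q$, i.e. the set of $x$ such that for each $i=1,\dots,m$ the vector of $i$-th coordinates $(x_{1,i}^+,\dots,x_{k,i}^+,x_{1,i}^-,\dots,x_{k,i}^-)$ lies in $Q$. Characteristic function: let $g\in\mathrm{GL}(\alpha+km,\mathbb Q_p)$ represent the double coset $\mathfrak g$, and let $Q,T\subset\mathcal H$ be self-dual submodules. $\chi_{\mathfrak g}(Q,T)\subset\mathcal V\oplus\mathcal V$ is the set of all $u\oplus v$, $u=u^+\oplus u^-$, $v=v^+\oplus v^-$, for which there exist $x\in Q\otimes\mathbb Z_p^m$, $y\in T\otimes\mathbb Z_p^m$ with $$\begin{pmatrix}v^+\\ y^+\end{pmatrix}=g\begin{pmatrix}u^+\\ x^+\end{pmatrix},\qquad \begin{pmatrix}v^-\\ y^-\end{pmatrix}=(g^t)^{-1}\begin{pmatrix}u^-\\ x^-\end{pmatrix},$$ where $x^\pm=(x_1^\pm,\dots,x_k^\pm)$, $y^\pm=(y_1^\pm,\dots,y_k^\pm)$ are columns. It depends only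 on $\mathfrak g$, not on $m$ or the representative $g$. *)

theory Defs
  imports
    "HOL-Algebra.Coset"
    "HOL-Computational_Algebra.Fraction_Field"
    "HOL-Library.Groups_Big_Fun"
    "Berlekamp_Zassenhaus.Finite_Field"
begin

section \<open>The \<open>p\<close>-adic numbers\<close>

text \<open>
  The prime is the cardinality \<open>p = CARD('p)\<close> of a type \<open>'p :: prime_card\<close>.  The ring of \<open>p\<close>-adic
  integers is the inverse limit of the rings \<open>\<int>/p^n\<close>, the residues mod \<open>p^n\<close> being represented in
  \<open>{0..<p^n}\<close>; the field of \<open>p\<close>-adic numbers is its field of fractions.
\<close>

typedef (overloaded) ('p :: prime_card) zp =
  "{f :: nat \<Rightarrow> int. \<forall>n. f n = f (Suc n) mod int CARD('p) ^ n}"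
  morphisms zp_residue Abs_zp
  by (rule exI[of _ "\<lambda>_. 0"]) simp

setup_lifting type_definition_zp

lemma zp_residue_Suc:
  "zp_residue (x :: 'p :: prime_card zp) n = zp_residue x (Suc n) mod int CARD('p) ^ n"
  using zp_residue[of x] unfolding mem_Collect_eq by (rule spec)

lemma zp_residue_mod [simp]:
  "zp_residue (x :: 'p :: prime_card zp) n mod int CARD('p) ^ n = zp_residue x n"
  by (subst (1 2) zp_residue_Suc) simp

lemma zp_residue_le:
  "m \<le> n \<Longrightarrow> zp_residue (x :: 'p :: prime_card zp) m = zp_residue x n mod int CARD('p) ^ m"
proof (induction n rule: dec_induct)
  case (step n)
  have "zp_residue x m = zp_residue x (Suc n) mod int CARD('p) ^ n mod int CARD('p) ^ m"
    using step.IH zp_residue_Suc[of x n] by simp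
  then show ?case
    using step.hyps by (simp add: mod_mod_cancel le_imp_power_dvd)
qed simp

lemma coherent_mod:
  fixes p a :: int
  shows "a mod p ^ n = (a mod p ^ Suc n) mod p ^ n"
  by (simp add: mod_mod_cancel le_imp_power_dvd del: power_Suc)

instantiation zp :: (prime_card) comm_ring_1
begin

lift_definition zero_zp :: "'a zp" is "\<lambda>n. 0" by simp

lift_definition one_zp :: "'a zp" is "\<lambda>n. 1 mod int CARD('a) ^ n"
  by (rule coherent_mod)

lift_definition plus_zp :: "'a zp \<Rightarrow> 'a zp \<Rightarrow> 'a zp"
  is "\<lambda>f g n. (f n + g n) mod int CARD('a) ^ n"
proof -
  fix f g :: "nat \<Rightarrow> int" and n
  assume "\<And>n. f n = f (Suc n) mod int CARD('a) ^ n" "\<And>n. g n = g (Suc n) mod int CARD('a) ^ n"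
  from this[of n] have "(f n + g n) mod int CARD('a) ^ n =
      (f (Suc n) + g (Suc n)) mod int CARD('a) ^ n"
    by (simp only: mod_add_eq)
  then show "(f n + g n) mod int CARD('a) ^ n =
      (f (Suc n) + g (Suc n)) mod int CARD('a) ^ Suc n mod int CARD('a) ^ n"
    by (simp only: coherent_mod[symmetric])
qed

lift_definition uminus_zp :: "'a zp \<Rightarrow> 'a zp" is "\<lambda>f n. (- f n) mod int CARD('a) ^ n"
proof -
  fix f :: "nat \<Rightarrow> int" and n
  assume "\<And>n. f n = f (Suc n) mod int CARD('a) ^ n"
  from this[of n] have "(- f n) mod int CARD('a) ^ n = (- f (Suc n)) mod int CARD('a) ^ n"
    by (simp only: mod_minus_eq)
  then show "(- f n) mod int CARD('a) ^ n =
      (- f (Suc n)) mod int CARD('a) ^ Suc n mod int CARD('a) ^ n"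
    by (simp only: coherent_mod[symmetric])
qed

definition minus_zp :: "'a zp \<Rightarrow> 'a zp \<Rightarrow> 'a zp" where
  "minus_zp x y = x + (- y)"

lift_definition times_zp :: "'a zp \<Rightarrow> 'a zp \<Rightarrow> 'a zp"
  is "\<lambda>f g n. (f n * g n) mod int CARD('a) ^ n"
proof -
  fix f g :: "nat \<Rightarrow> int" and n
  assume "\<And>n. f n = f (Suc n) mod int CARD('a) ^ n" "\<And>n. g n = g (Suc n) mod int CARD('a) ^ n"
  from this[of n] have "(f n * g n) mod int CARD('a) ^ n =
      (f (Suc n) * g (Suc n)) mod int CARD('a) ^ n"
    by (simp only: mod_mult_eq)
  then show "(f n * g n) mod int CARD('a) ^ n =
      (f (Suc n) * g (Suc n)) mod int CARD('a) ^ Suc n mod int CARD('a) ^ n"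
    by (simp only: coherent_mod[symmetric])
qed

instance
proof
  fix a b c :: "'a zp"
  note eqI = zp_residue_inject[THEN iffD1, OF ext]
  show "a * b * c = a * (b * c)"
    by (rule eqI) (simp add: times_zp.rep_eq mod_mult_left_eq mod_mult_right_eq mult.assoc)
  show "a * b = b * a"
    by (rule eqI) (simp add: times_zp.rep_eq mult.commute)
  show "1 * a = a"
    by (rule eqI) (simp add: times_zp.rep_eq one_zp.rep_eq mod_mult_left_eq)
  show "a + b + c = a + (b + c)"
    by (rule eqI) (simp add: plus_zp.rep_eq mod_add_left_eq mod_add_right_eq add.assoc)
  show "a + b = b + a"
    by (rule eqI) (simp add: plus_zp.rep_eq add.commute)
  show "0 + a = a"
    by (rule eqI) (simp add: plus_zp.rep_eq zero_zp.rep_eq)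
  show "- a + a = 0"
    by (rule eqI) (simp add: plus_zp.rep_eq zero_zp.rep_eq uminus_zp.rep_eq mod_add_left_eq)
  show "a - b = a + - b"
    by (simp add: minus_zp_def)
  show "(a + b) * c = a * c + b * c"
    by (rule eqI) (simp add: plus_zp.rep_eq times_zp.rep_eq mod_mult_left_eq mod_add_eq
        distrib_right)
  have "zp_residue (0 :: 'a zp) 1 \<noteq> zp_residue 1 1"
    using prime_gt_1_int[OF prime_card_int[where 'a = 'a]]
    by (simp add: zero_zp.rep_eq one_zp.rep_eq)
  then show "(0 :: 'a zp) \<noteq> 1" by metis
qed

end

instance zp :: (prime_card) idom
proof
  fix a b :: "'a zp"
  let ?p = "int CARD('a)"
  have p: "prime ?p" by (rule prime_card_int)
  have dvd: "?p ^ m dvd zp_residue x n \<longleftrightarrow> zp_residue x m = 0" if "m \<le> n" for x :: "'a zp" and m n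
    using zp_residue_le[OF that, of x] by (simp add: dvd_eq_mod_eq_0)
  assume "a \<noteq> 0" "b \<noteq> 0"
  then obtain m n where "zp_residue a m \<noteq> 0" "zp_residue b n \<noteq> 0"
    by (metis zp_residue_inject zero_zp.rep_eq ext)
  then have nd: "\<not> ?p ^ m dvd zp_residue a (m + n)" "\<not> ?p ^ n dvd zp_residue b (m + n)"
    using dvd by simp_all
  have "\<not> ?p ^ (m + n) dvd zp_residue a (m + n) * zp_residue b (m + n)"
  proof
    assume d: "?p ^ (m + n) dvd zp_residue a (m + n) * zp_residue b (m + n)"
    have nz: "zp_residue a (m + n) \<noteq> 0" "zp_residue b (m + n) \<noteq> 0"
      using nd by auto
    have "m + n \<le> multiplicity ?p (zp_residue a (m + n) * zp_residue b (m + n))"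
      using d nz p by (intro multiplicity_geI) auto
    also have "\<dots> = multiplicity ?p (zp_residue a (m + n)) + multiplicity ?p (zp_residue b (m + n))"
      using nz p by (simp add: prime_elem_multiplicity_mult_distrib)
    finally have "m \<le> multiplicity ?p (zp_residue a (m + n)) \<or>
        n \<le> multiplicity ?p (zp_residue b (m + n))"
      by linarith
    then show False
      using nd multiplicity_dvd' by blast
  qed
  then have "zp_residue (a * b) (m + n) \<noteq> 0"
    by (simp add: times_zp.rep_eq dvd_eq_mod_eq_0)
  then show "a * b \<noteq> 0"
    by (metis zero_zp.rep_eq)
qed

type_synonym 'p qp = "'p zp fract"

definition Zp :: "'p :: prime_card qp set" where
  "Zp = range (\<lambda>a. Fract a 1)"

section \<open>Submodules and skew-symmetric forms\<close>

text \<open>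
  \<open>coord_space I\<close> is the space of columns indexed by \<open>I\<close>: functions on the ambient index type that
  vanish outside \<open>I\<close>.  A direct sum of coordinate spaces is a coordinate space over a disjoint union
  of index sets, and \<open>u \<oplus> v\<close> is \<open>case_sum u v\<close>.
\<close>

definition coord_space :: "'i set \<Rightarrow> ('i \<Rightarrow> 'p :: prime_card qp) set" where
  "coord_space I = {v. \<forall>i. i \<notin> I \<longrightarrow> v i = 0}"

definition zp_submodule ::
    "('i \<Rightarrow> 'p :: prime_card qp) set \<Rightarrow> ('i \<Rightarrow> 'p qp) set \<Rightarrow> bool" where
  "zp_submodule V R \<longleftrightarrow> R \<subseteq> V \<and> (\<lambda>_. 0) \<in> R \<and>
     (\<forall>v\<in>R. \<forall>w\<in>R. (\<lambda>i. v i + w i) \<in> R) \<and> (\<forall>c\<in>Zp. \<forall>v\<in>R. (\<lambda>i. c * v i) \<in> R)"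

definition isotropic ::
    "('i \<Rightarrow> 'p :: prime_card qp) set \<Rightarrow> (('i \<Rightarrow> 'p qp) \<Rightarrow> ('i \<Rightarrow> 'p qp) \<Rightarrow> 'p qp)
      \<Rightarrow> ('i \<Rightarrow> 'p qp) set \<Rightarrow> bool" where
  "isotropic V B R \<longleftrightarrow> zp_submodule V R \<and> (\<forall>v\<in>R. \<forall>w\<in>R. B v w \<in> Zp)"

definition self_dual ::
    "('i \<Rightarrow> 'p :: prime_card qp) set \<Rightarrow> (('i \<Rightarrow> 'p qp) \<Rightarrow> ('i \<Rightarrow> 'p qp) \<Rightarrow> 'p qp)
      \<Rightarrow> ('i \<Rightarrow> 'p qp) set \<Rightarrow> bool" where
  "self_dual V B R \<longleftrightarrow> isotropic V B R \<and> (\<forall>R'. isotropic V B R' \<and> R \<subseteq> R' \<longrightarrow> R' = R)"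

text \<open>
  \<open>sympl_space n\<close> is the sum of two copies of the \<open>n\<close>-dimensional coordinate space (\<open>Inl\<close> indexes the
  plus part and \<open>Inr\<close> the minus part), and \<open>sympl_form n\<close> is the form with matrix \<open>(0, 1; -1, 0)\<close>.
  Thus \<open>\<V> = sympl_space \<alpha>\<close> and \<open>\<H> = sympl_space k\<close>.
\<close>

definition sympl_space :: "nat \<Rightarrow> (nat + nat \<Rightarrow> 'p :: prime_card qp) set" where
  "sympl_space n = coord_space ({..<n} <+> {..<n})"

definition sympl_form ::
    "nat \<Rightarrow> (nat + nat \<Rightarrow> 'p :: prime_card qp) \<Rightarrow> (nat + nat \<Rightarrow> 'p qp) \<Rightarrow> 'p qp" where
  "sympl_form n u u' = (\<Sum>i<n. u (Inl i) * u' (Inr i) - u (Inr i) * u' (Inl i))"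

definition sympl_space2 :: "nat \<Rightarrow> ((nat + nat) + (nat + nat) \<Rightarrow> 'p :: prime_card qp) set" where
  "sympl_space2 n = {case_sum u v | u v. u \<in> sympl_space n \<and> v \<in> sympl_space n}"

definition sympl_form_ominus ::
    "nat \<Rightarrow> ((nat + nat) + (nat + nat) \<Rightarrow> 'p :: prime_card qp)
      \<Rightarrow> ((nat + nat) + (nat + nat) \<Rightarrow> 'p qp) \<Rightarrow> 'p qp" where
  "sympl_form_ominus n w w' =
     sympl_form n (w \<circ> Inl) (w' \<circ> Inl) - sympl_form n (w \<circ> Inr) (w' \<circ> Inr)"

definition Naz_bar :: "nat \<Rightarrow> ((nat + nat) + (nat + nat) \<Rightarrow> 'p :: prime_card qp) set set" where
  "Naz_bar n = {R. self_dual (sympl_space2 n) (sympl_form_ominus n) R}"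

section \<open>Finitary matrices\<close>

text \<open>
  A matrix with rows and columns indexed by \<open>I\<close> is a function vanishing outside \<open>I \<times> I\<close>.  \<open>Sum_any\<close> is
  the sum over the support of the summand, which is finite for products of finitary matrices and for
  finitary matrices applied to finitely supported columns.
\<close>

type_synonym ('i, 'p) qmat = "'i \<Rightarrow> 'i \<Rightarrow> 'p qp"

definition one_mat :: "'i set \<Rightarrow> ('i, 'p :: prime_card) qmat" where
  "one_mat I a b = (if a = b \<and> a \<in> I then 1 else 0)"

definition mat_mul ::
    "('i, 'p :: prime_card) qmat \<Rightarrow> ('i, 'p) qmat \<Rightarrow> ('i, 'p) qmat" where
  "mat_mul g h a c = Sum_any (\<lambda>b. g a b * h b c)"

definition mat_vec ::
    "('i, 'p :: prime_card) qmat \<Rightarrow> ('i \<Rightarrow> 'p qp) \<Rightarrow> ('i \<Rightarrow> 'p qp)" where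
  "mat_vec g w a = Sum_any (\<lambda>b. g a b * w b)"

definition mat_transp :: "('i, 'p :: prime_card) qmat \<Rightarrow> ('i, 'p) qmat" where
  "mat_transp g a b = g b a"

definition finitary :: "'i set \<Rightarrow> ('i, 'p :: prime_card) qmat \<Rightarrow> bool" where
  "finitary I g \<longleftrightarrow> (\<forall>a b. (a, b) \<notin> I \<times> I \<longrightarrow> g a b = 0) \<and>
     finite {(a, b). g a b - one_mat I a b \<noteq> 0}"

definition finitary_monoid :: "'i set \<Rightarrow> ('i, 'p :: prime_card) qmat monoid" where
  "finitary_monoid I = \<lparr>carrier = {g. finitary I g}, Group.monoid.mult = mat_mul, one = one_mat I\<rparr>"

definition GL_fin :: "'i set \<Rightarrow> ('i, 'p :: prime_card) qmat monoid" where
  "GL_fin I = units_of (finitary_monoid I)"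

definition O_inf_Zp :: "(nat, 'p :: prime_card) qmat set" where
  "O_inf_Zp = {u. finitary UNIV u \<and> (\<forall>a b. u a b \<in> Zp) \<and>
     mat_mul u (mat_transp u) = one_mat UNIV \<and> mat_mul (mat_transp u) u = one_mat UNIV}"

section \<open>The groups \<open>\<^bold>G\<close> and \<open>\<^bold>K\<close>\<close>

text \<open>
  The index set of \<open>\<alpha> + k\<infinity>\<close>: \<open>Inl a\<close> for the finite block and \<open>Inr (j, i)\<close> for the \<open>i\<close>-th coordinate
  of the \<open>j\<close>-th infinite block.
\<close>

type_synonym idx = "nat + nat \<times> nat"

definition idx_set :: "nat \<Rightarrow> nat \<Rightarrow> idx set" where
  "idx_set \<alpha> k = {..<\<alpha>} <+> ({..<k} \<times> UNIV)"

definition idx_set_fin :: "nat \<Rightarrow> nat \<Rightarrow> nat \<Rightarrow> idx set" where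
  "idx_set_fin \<alpha> k m = {..<\<alpha>} <+> ({..<k} \<times> {..<m})"

definition bG :: "nat \<Rightarrow> nat \<Rightarrow> (idx, 'p :: prime_card) qmat monoid" where
  "bG \<alpha> k = GL_fin (idx_set \<alpha> k)"

text \<open>The subgroup \<open>GL(\<alpha> + km)\<close> of \<open>\<^bold>G\<close>.\<close>

definition bG_fin :: "nat \<Rightarrow> nat \<Rightarrow> nat \<Rightarrow> (idx, 'p :: prime_card) qmat set" where
  "bG_fin \<alpha> k m = {g \<in> carrier (bG \<alpha> k).
     \<forall>a b. (a, b) \<notin> idx_set_fin \<alpha> k m \<times> idx_set_fin \<alpha> k m \<longrightarrow> g a b = one_mat (idx_set \<alpha> k) a b}"

definition frakI :: "nat \<Rightarrow> nat \<Rightarrow> (nat, 'p :: prime_card) qmat \<Rightarrow> (idx, 'p) qmat" where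
  "frakI \<alpha> k u a b = (case (a, b) of
      (Inl i, Inl i') \<Rightarrow> if i = i' \<and> i < \<alpha> then 1 else 0
    | (Inr (j, i), Inr (j', i')) \<Rightarrow> if j = j' \<and> j < k then u i i' else 0
    | _ \<Rightarrow> 0)"

definition bK :: "nat \<Rightarrow> nat \<Rightarrow> (idx, 'p :: prime_card) qmat set" where
  "bK \<alpha> k = frakI \<alpha> k ` O_inf_Zp"

definition double_cosets :: "nat \<Rightarrow> nat \<Rightarrow> (idx, 'p :: prime_card) qmat set set" where
  "double_cosets \<alpha> k =
     {(bK \<alpha> k #>\<^bsub>bG \<alpha> k\<^esub> g) <#>\<^bsub>bG \<alpha> k\<^esub> bK \<alpha> k | g. g \<in> carrier (bG \<alpha> k)}"

section \<open>The characteristic function\<close>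

text \<open>
  An element \<open>x\<close> of \<open>\<H> \<otimes> \<rat>\<^sub>p\<^sup>m\<close> is represented by its sequence of coordinate vectors: \<open>x i \<in> \<H>\<close> is the
  vector of the \<open>i\<close>-th coordinates of \<open>x\<^sub>1\<^sup>+, \<dots>, x\<^sub>k\<^sup>-\<close>, and \<open>x i = 0\<close> for \<open>i \<ge> m\<close>.
\<close>

definition tensor_Zp ::
    "nat \<Rightarrow> (nat + nat \<Rightarrow> 'p :: prime_card qp) set \<Rightarrow> (nat \<Rightarrow> nat + nat \<Rightarrow> 'p qp) set" where
  "tensor_Zp m Q = {x. (\<forall>i<m. x i \<in> Q) \<and> (\<forall>i\<ge>m. x i = (\<lambda>_. 0))}"

text \<open>The columns \<open>(u\<^sup>+, x\<^sup>+)\<close> and \<open>(u\<^sup>-, x\<^sup>-)\<close>.\<close>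

definition col_plus ::
    "(nat + nat \<Rightarrow> 'p :: prime_card qp) \<Rightarrow> (nat \<Rightarrow> nat + nat \<Rightarrow> 'p qp) \<Rightarrow> (idx \<Rightarrow> 'p qp)" where
  "col_plus u x = case_sum (\<lambda>a. u (Inl a)) (\<lambda>(j, i). x i (Inl j))"

definition col_minus ::
    "(nat + nat \<Rightarrow> 'p :: prime_card qp) \<Rightarrow> (nat \<Rightarrow> nat + nat \<Rightarrow> 'p qp) \<Rightarrow> (idx \<Rightarrow> 'p qp)" where
  "col_minus u x = case_sum (\<lambda>a. u (Inr a)) (\<lambda>(j, i). x i (Inr j))"

definition chi_rep ::
    "nat \<Rightarrow> nat \<Rightarrow> nat \<Rightarrow> (idx, 'p :: prime_card) qmat
      \<Rightarrow> (nat + nat \<Rightarrow> 'p qp) set \<Rightarrow> (nat + nat \<Rightarrow> 'p qp) set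
      \<Rightarrow> ((nat + nat) + (nat + nat) \<Rightarrow> 'p qp) set" where
  "chi_rep \<alpha> k m g Q T = {case_sum u v | u v. u \<in> sympl_space \<alpha> \<and> v \<in> sympl_space \<alpha> \<and>
     (\<exists>x \<in> tensor_Zp m Q. \<exists>y \<in> tensor_Zp m T.
        col_plus v y = mat_vec g (col_plus u x) \<and>
        col_minus v y = mat_vec (inv\<^bsub>bG \<alpha> k\<^esub> (mat_transp g)) (col_minus u x))}"

text \<open>
  The common value of \<open>chi_rep \<alpha> k m g Q T\<close> over all \<open>m\<close> and all representatives
  \<open>g \<in> GL(\<alpha> + km)\<close> of the double coset \<open>\<gg>\<close>.  The description is proper because the set depends
  on neither choice (for self-dual \<open>Q\<close> and \<open>T\<close>).
\<close>

definition chi ::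
    "nat \<Rightarrow> nat \<Rightarrow> (idx, 'p :: prime_card) qmat set
      \<Rightarrow> (nat + nat \<Rightarrow> 'p qp) set \<Rightarrow> (nat + nat \<Rightarrow> 'p qp) set
      \<Rightarrow> ((nat + nat) + (nat + nat) \<Rightarrow> 'p qp) set" where
  "chi \<alpha> k \<gg> Q T = (THE C. \<exists>m g. g \<in> \<gg> \<inter> bG_fin \<alpha> k m \<and> C = chi_rep \<alpha> k m g Q T)"

end

theory Submission
  imports Defs "HOL-Number_Theory.Cong"
begin


text \<open>
  The relation \<open>(v, y)\<^sup>+ = g (u, x)\<^sup>+\<close>, \<open>(u, x)\<^sup>- = g\<^sup>t (v, y)\<^sup>-\<close> is Lagrangian, which makes
  \<open>\<chi>(Q, T)\<close> isotropic.  For maximality, let \<open>u\<^sub>0 \<oplus> v\<^sub>0\<close> be orthogonal to \<open>\<chi>(Q, T)\<close> and let \<open>S\<close> be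
  the submodule of all \<open>(y\<^sup>+ - g x\<^sup>+, x\<^sup>- - g\<^sup>t y\<^sup>-)\<close> with \<open>x\<close> over \<open>Q\<close> and \<open>y\<close> over \<open>T\<close>.  Then
  \<open>u\<^sub>0 \<oplus> v\<^sub>0\<close> lies in \<open>\<chi>(Q, T)\<close> iff \<open>e = (g u\<^sub>0\<^sup>+ - v\<^sub>0\<^sup>+, g\<^sup>t v\<^sub>0\<^sup>- - u\<^sub>0\<^sup>-)\<close> lies in \<open>S\<close>.  If not, a linear
  functional \<open>(c, d)\<close> is integral on \<open>S\<close> but not at \<open>e\<close>; such a functional exists for every
  submodule of a finite-dimensional space because \<open>\<int>\<^sub>p\<close> is a complete valuation ring.  Self-duality of \<open>Q\<close> and
  \<open>T\<close> turns \<open>(c, d)\<close> into the element of \<open>\<chi>(Q, T)\<close> with source \<open>(d, g\<^sup>t c)\<close> and target \<open>(g d, c)\<close>, whose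
  pairing with \<open>u\<^sub>0 \<oplus> v\<^sub>0\<close> is, up to sign, the value at \<open>e\<close>, a contradiction.
\<close>

section \<open>Arithmetic of the \<open>p\<close>-adic integers\<close>

lemma zp_eqI: "(\<And>n. zp_residue x n = zp_residue y n) \<Longrightarrow> x = (y :: 'p :: prime_card zp)"
  by (rule zp_residue_inject[THEN iffD1, OF ext])

lemma zp_residue_of_nat: "zp_residue (of_nat k :: 'p :: prime_card zp) n = int k mod int CARD('p) ^ n"
proof (induction k)
  case 0 show ?case by (simp add: zero_zp.rep_eq)
next
  case (Suc k) then show ?case
    by (simp add: plus_zp.rep_eq one_zp.rep_eq mod_add_eq)
qed

lemma zp_residue_p_power_mult:
  "zp_residue (of_nat (CARD('p) ^ n) * (b :: 'p :: prime_card zp)) k =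
    (int CARD('p) ^ n * zp_residue b k) mod int CARD('p) ^ k"
  unfolding times_zp.rep_eq zp_residue_of_nat mod_mult_left_eq by simp

text \<open>The quotient of \<open>a\<close> by \<open>p^n\<close> is built residue by residue:
  shift the sequence of residues by \<open>n\<close> and divide by \<open>p^n\<close>.\<close>

lemma p_power_dvd_iff:
  "of_nat (CARD('p) ^ n) dvd (a :: 'p :: prime_card zp) \<longleftrightarrow> zp_residue a n = 0"
proof
  assume "of_nat (CARD('p) ^ n) dvd a"
  then obtain b where "a = of_nat (CARD('p) ^ n) * b" ..
  then show "zp_residue a n = 0"
    by (simp add: zp_residue_p_power_mult del: of_nat_power)
next
  assume 0: "zp_residue a n = 0"
  let ?p = "int CARD('p)"
  have pos: "?p > 0" by simp
  have co: "zp_residue a (n + k) div ?p ^ n = zp_residue a (n + Suc k) div ?p ^ n mod ?p ^ k" for k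
  proof -
    have "zp_residue a (n + k) = zp_residue a (n + Suc k) mod (?p ^ n * ?p ^ k)"
      using zp_residue_Suc[of a "n + k"] by (simp add: power_add)
    also have "\<dots> = ?p ^ n * (zp_residue a (n + Suc k) div ?p ^ n mod ?p ^ k)
        + zp_residue a (n + Suc k) mod ?p ^ n"
      by (simp add: zmod_zmult2_eq)
    also have "zp_residue a (n + Suc k) mod ?p ^ n = 0"
      using zp_residue_le[of n "n + Suc k" a] 0 by simp
    finally show ?thesis by simp
  qed
  define b :: "'p zp" where "b = Abs_zp (\<lambda>k. zp_residue a (n + k) div ?p ^ n)"
  have b: "zp_residue b k = zp_residue a (n + k) div ?p ^ n" for k
    unfolding b_def by (subst Abs_zp_inverse) (simp_all only: mem_Collect_eq co[symmetric] simp_thms)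
  have "a = of_nat (CARD('p) ^ n) * b"
  proof (rule zp_eqI)
    fix k
    have "?p ^ n dvd zp_residue a (n + k)"
      using zp_residue_le[of n "n + k" a] 0 by (simp add: dvd_eq_mod_eq_0)
    then have div: "?p ^ n * (zp_residue a (n + k) div ?p ^ n) = zp_residue a (n + k)" by simp
    have "zp_residue (of_nat (CARD('p) ^ n) * b) k =
        (?p ^ n * zp_residue b k) mod ?p ^ k"
      by (rule zp_residue_p_power_mult)
    also have "\<dots> = zp_residue a (n + k) mod ?p ^ k"
      unfolding b div ..
    also have "\<dots> = zp_residue a k"
      using zp_residue_le[of k "n + k" a] by simp
    finally show "zp_residue a k = zp_residue (of_nat (CARD('p) ^ n) * b) k" by simp
  qed
  then show "of_nat (CARD('p) ^ n) dvd a" by (rule dvdI)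
qed

text \<open>The residues modulo \<open>p^n\<close> stabilise from the n-th term on, so the diagonal
  of the residues is coherent and defines the limit.\<close>

lemma zp_complete:
  fixes a :: "nat \<Rightarrow> 'p :: prime_card zp"
  assumes "\<And>n. of_nat (CARD('p) ^ n) dvd a (Suc n) - a n"
  shows "\<exists>c. \<forall>n. of_nat (CARD('p) ^ n) dvd c - a n"
proof -
  let ?p = "int CARD('p)"
  have dvd_diff: "of_nat (CARD('p) ^ n) dvd x - y \<longleftrightarrow> zp_residue x n = zp_residue y n"
    for x y :: "'p zp" and n
  proof -
    have "zp_residue (x - y) n = (zp_residue x n - zp_residue y n) mod ?p ^ n"
      unfolding minus_zp_def plus_zp.rep_eq uminus_zp.rep_eq mod_add_right_eq by simp
    moreover have "(zp_residue x n - zp_residue y n) mod ?p ^ n = 0 \<longleftrightarrow>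
        zp_residue x n mod ?p ^ n = zp_residue y n mod ?p ^ n"
      unfolding mod_eq_dvd_iff dvd_eq_mod_eq_0 ..
    ultimately show ?thesis unfolding p_power_dvd_iff zp_residue_mod by simp
  qed
  define c :: "'p zp" where "c = Abs_zp (\<lambda>n. zp_residue (a n) n)"
  have "zp_residue c n = zp_residue (a n) n" for n
    unfolding c_def
  proof (subst Abs_zp_inverse)
    show "(\<lambda>n. zp_residue (a n) n) \<in> {f. \<forall>n. f n = f (Suc n) mod ?p ^ n}"
      using assms unfolding dvd_diff mem_Collect_eq zp_residue_Suc[symmetric] by metis
  qed (rule refl)
  then show ?thesis unfolding dvd_diff by blast
qed

text \<open>A nonzero residue modulo \<open>p\<close> makes all residues prime to \<open>p\<close>,
  so each can be inverted modulo \<open>p^n\<close>. Inverses modulo \<open>p^n\<close> are unique,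
  which makes the chosen ones coherent.\<close>

lemma zp_unit:
  assumes "zp_residue (a :: 'p :: prime_card zp) 1 \<noteq> 0"
  shows "a dvd 1"
proof -
  let ?p = "int CARD('p)"
  have cop: "coprime (zp_residue a n) (?p ^ n)" for n
  proof (cases "n = 0")
    case False
    have "\<not> ?p dvd zp_residue a n"
      using assms zp_residue_le[of 1 n a] False by (simp add: dvd_eq_mod_eq_0)
    then have "coprime ?p (zp_residue a n)"
      by (rule prime_imp_coprime[OF prime_card_int])
    then show ?thesis by (simp add: coprime_commute)
  qed simp
  have "\<exists>b. [zp_residue a n * b = 1] (mod ?p ^ n)" for n
    using cong_solve_coprime_int[OF cop] by blast
  then obtain b where b: "\<And>n. [zp_residue a n * b n = 1] (mod ?p ^ n)" by metis
  define c :: "'p zp" where "c = Abs_zp (\<lambda>n. b n mod ?p ^ n)"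
  have co: "b n mod ?p ^ n = b (Suc n) mod ?p ^ n" for n
  proof -
    have "[zp_residue a (Suc n) * b (Suc n) = 1] (mod ?p ^ n)"
      using b[of "Suc n"] by (rule cong_dvd_modulus) simp
    moreover have "[zp_residue a (Suc n) = zp_residue a n] (mod ?p ^ n)"
      using zp_residue_Suc[of a n] by (simp add: cong_def)
    ultimately have "[zp_residue a n * b (Suc n) = 1] (mod ?p ^ n)"
      by (meson cong_scalar_right cong_sym cong_trans)
    then have "[zp_residue a n * b n = zp_residue a n * b (Suc n)] (mod ?p ^ n)"
      using b[of n] by (meson cong_sym cong_trans)
    then show ?thesis
      using cop[of n] by (simp add: cong_mult_lcancel cong_def[symmetric])
  qed
  have c: "zp_residue c n = b n mod ?p ^ n" for n
    unfolding c_def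
  proof (subst Abs_zp_inverse)
    show "(\<lambda>n. b n mod ?p ^ n) \<in> {f. \<forall>n. f n = f (Suc n) mod ?p ^ n}"
      unfolding mem_Collect_eq coherent_mod[symmetric] by (intro allI co)
  qed simp
  have "1 = a * c"
    by (rule zp_eqI) (use b in \<open>simp add: times_zp.rep_eq one_zp.rep_eq c mod_mult_right_eq cong_def\<close>)
  then show ?thesis by (rule dvdI)
qed

lemma zp_eq_p_power_mult_unit:
  assumes "(a :: 'p :: prime_card zp) \<noteq> 0"
  shows "\<exists>n u. a = of_nat (CARD('p) ^ n) * u \<and> u dvd 1"
proof -
  have "\<exists>n. zp_residue a n \<noteq> 0"
    using assms zp_eqI[of a 0] by (auto simp: zero_zp.rep_eq)
  \<comment> \<open>The residue modulo \<open>p^0\<close> vanishes, so this index is positive. Its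
    predecessor \<open>m\<close>, the last index at which the residue still vanishes, is the
    exponent of \<open>p\<close>.\<close>
  define n where "n = (LEAST n. zp_residue a n \<noteq> 0)"
  have n: "zp_residue a n \<noteq> 0"
    unfolding n_def by (rule LeastI_ex) fact
  have "zp_residue a 0 = 0" using zp_residue_mod[of a 0] by simp
  then obtain m where m: "n = Suc m" using n by (cases n) auto
  have "zp_residue a m = 0"
    using not_less_Least[of m "\<lambda>n. zp_residue a n \<noteq> 0"] m n_def by auto
  then obtain u where u: "a = of_nat (CARD('p) ^ m) * u"
    using p_power_dvd_iff[of m a] by (auto elim: dvdE)
  have "zp_residue u 1 \<noteq> 0"
  proof
    assume "zp_residue u 1 = 0"
    then have "of_nat (CARD('p) ^ 1) dvd u" by (simp only: p_power_dvd_iff)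
    then have "of_nat (CARD('p) ^ n) dvd a"
      by (auto simp: u m elim!: dvdE)
    then show False using n by (simp only: p_power_dvd_iff)
  qed
  then show ?thesis using u zp_unit by blast
qed

section \<open>Duality for \<open>\<int>\<^sub>p\<close>-submodules\<close>

lemma Zp_0 [simp]: "(0 :: 'p :: prime_card qp) \<in> Zp"
  unfolding Zp_def Zero_fract_def by blast

lemma Zp_1 [simp]: "(1 :: 'p :: prime_card qp) \<in> Zp"
  unfolding Zp_def One_fract_def by blast

lemma Fract_1_eq_0_iff: "Fract a 1 = 0 \<longleftrightarrow> a = (0 :: 'p :: prime_card zp)"
  by (simp add: Zero_fract_def eq_fract)

lemma Zp_add: "x \<in> Zp \<Longrightarrow> y \<in> Zp \<Longrightarrow> x + (y :: 'p :: prime_card qp) \<in> Zp"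
  unfolding Zp_def by fastforce

lemma Zp_mult: "x \<in> Zp \<Longrightarrow> y \<in> Zp \<Longrightarrow> x * (y :: 'p :: prime_card qp) \<in> Zp"
  unfolding Zp_def by fastforce

lemma Zp_uminus: "x \<in> Zp \<Longrightarrow> - (x :: 'p :: prime_card qp) \<in> Zp"
  unfolding Zp_def by fastforce

lemma Zp_diff: "x \<in> Zp \<Longrightarrow> y \<in> Zp \<Longrightarrow> x - (y :: 'p :: prime_card qp) \<in> Zp"
  using Zp_add[OF _ Zp_uminus] by fastforce

lemma Zp_sum: "(\<And>i. i \<in> A \<Longrightarrow> f i \<in> Zp) \<Longrightarrow> sum f A \<in> (Zp :: 'p :: prime_card qp set)"
  by (induction A rule: infinite_finite_induct) (auto intro: Zp_add)

definition p_qp :: "'p :: prime_card qp" where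
  "p_qp = of_nat CARD('p)"

lemma p_qp_power: "(p_qp :: 'p :: prime_card qp) ^ n = Fract (of_nat (CARD('p) ^ n)) 1"
proof -
  have "(p_qp :: 'p qp) ^ n = of_nat (CARD('p) ^ n)" by (simp add: p_qp_def)
  also have "\<dots> = Fract (of_nat (CARD('p) ^ n)) 1" by (rule of_nat_fract)
  finally show ?thesis .
qed

lemma p_power_zp_nonzero: "(of_nat (CARD('p) ^ n) :: 'p :: prime_card zp) \<noteq> 0"
proof
  assume 0: "(of_nat (CARD('p) ^ n) :: 'p zp) = 0"
  have "zp_residue (of_nat (CARD('p) ^ n) :: 'p zp) (Suc n) = int CARD('p) ^ n"
    using prime_gt_1_int[OF prime_card_int[where 'a = 'p]]
    unfolding zp_residue_of_nat by simp
  then show False unfolding 0 by (simp add: zero_zp.rep_eq)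
qed

lemma p_qp_nonzero [simp]: "(p_qp :: 'p :: prime_card qp) \<noteq> 0"
  using p_qp_power[of 1, where 'p = 'p] p_power_zp_nonzero[of 1, where 'p = 'p]
  by (metis Fract_1_eq_0_iff power_one_right)

lemma p_qp_power_Zp: "(p_qp :: 'p :: prime_card qp) ^ n \<in> Zp"
  unfolding Zp_def p_qp_power by blast

text \<open>Supplies a nonzero class modulo \<open>Zp\<close> that is killed by \<open>p\<close>;
  the separating functional will take this value at \<open>e\<close>.\<close>

lemma inverse_p_qp_notin_Zp: "1 / (p_qp :: 'p :: prime_card qp) \<notin> Zp"
proof
  assume "1 / (p_qp :: 'p qp) \<in> Zp"
  then obtain a :: "'p zp" where "1 / p_qp = Fract a 1" unfolding Zp_def by blast
  then have "1 = p_qp ^ 1 * Fract a 1" by (simp add: field_simps)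
  then have "1 = of_nat (CARD('p) ^ 1) * a"
    unfolding p_qp_power by (simp add: One_fract_def eq_fract)
  then have "of_nat (CARD('p) ^ 1) dvd (1 :: 'p zp)" by (rule dvdI)
  then show False
    using prime_gt_1_int[OF prime_card_int[where 'a = 'p]]
    unfolding p_power_dvd_iff by (simp add: one_zp.rep_eq)
qed

lemma Zp_eq_p_power_mult_unit:
  assumes "x \<in> Zp" "x \<noteq> (0 :: 'p :: prime_card qp)"
  obtains n u where "x = p_qp ^ n * u" "u \<in> Zp" "u \<noteq> 0" "inverse u \<in> Zp"
proof -
  from assms(1) obtain a where a: "x = Fract a 1" unfolding Zp_def by blast
  with assms(2) have "a \<noteq> 0" by (auto simp: Zero_fract_def)
  then obtain n u v where u: "a = of_nat (CARD('p) ^ n) * u" and v: "1 = u * v"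
    using zp_eq_p_power_mult_unit[of a] by (auto elim: dvdE)
  have 1: "Fract u 1 * Fract v 1 = 1" by (simp add: v[symmetric] One_fract_def)
  then have "inverse (Fract u 1) = Fract v 1" by (rule inverse_unique)
  moreover have "Fract u 1 \<noteq> 0" using v by (auto simp: Fract_1_eq_0_iff)
  moreover have "x = p_qp ^ n * Fract u 1" unfolding p_qp_power a u by simp
  ultimately show ?thesis using that[of n "Fract u 1"] unfolding Zp_def by auto
qed

text \<open>The valuation is the integer \<open>n - m\<close>; two natural exponents stand for
  it.\<close>

lemma qp_eq_p_power_mult_unit:
  assumes "x \<noteq> (0 :: 'p :: prime_card qp)"
  obtains n m u where "x = p_qp ^ n * u / p_qp ^ m" "u \<in> Zp" "u \<noteq> 0" "inverse u \<in> Zp"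
proof -
  obtain a b :: "'p zp" where "x = Fract a b" "b \<noteq> 0" by (cases x) auto
  then have "x = Fract a 1 / Fract b 1" by simp
  then obtain y z where x: "x = y / z" and "y \<in> Zp" "z \<in> Zp"
    unfolding Zp_def by blast
  have "y \<noteq> 0" "z \<noteq> 0" using assms x by auto
  obtain n u where y: "y = p_qp ^ n * u" "u \<in> Zp" "u \<noteq> 0" "inverse u \<in> Zp"
    using Zp_eq_p_power_mult_unit[OF \<open>y \<in> Zp\<close> \<open>y \<noteq> 0\<close>] by blast
  obtain m v where z: "z = p_qp ^ m * v" "v \<in> Zp" "v \<noteq> 0" "inverse v \<in> Zp"
    using Zp_eq_p_power_mult_unit[OF \<open>z \<in> Zp\<close> \<open>z \<noteq> 0\<close>] by blast
  show ?thesis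
  proof (rule that)
    show "x = p_qp ^ n * (u * inverse v) / p_qp ^ m"
      unfolding x y(1) z(1) using z(3) by (simp add: divide_simps)
    show "u * inverse v \<in> Zp" "inverse (u * inverse v) \<in> Zp" "u * inverse v \<noteq> 0"
      using Zp_mult[OF y(2) z(4)] Zp_mult[OF y(4) z(2)] y(3) z(3) by simp_all
  qed
qed

lemma qp_eq_Zp_div_p_power:
  obtains n r where "x = r / p_qp ^ n" "r \<in> (Zp :: 'p :: prime_card qp set)"
proof (cases "x = 0")
  case True then show ?thesis using that[of 0 0] by simp
next
  case False
  then obtain n m u where "x = p_qp ^ n * u / p_qp ^ m" "u \<in> Zp"
    by (rule qp_eq_p_power_mult_unit)
  then show ?thesis using that Zp_mult[OF p_qp_power_Zp] by blast
qed

text \<open>The valuation ring property: of two nonzero elements, one of larger or equal valuation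
  is an integral multiple of the other.\<close>

lemma Zp_total:
  "(\<exists>r\<in>Zp. x = r * y) \<or> (\<exists>r\<in>Zp. y = r * (x :: 'p :: prime_card qp))"
proof (cases "x = 0 \<or> y = 0")
  case True then show ?thesis by (auto intro: bexI[of _ 0])
next
  case False
  then have "x \<noteq> 0" "y \<noteq> 0" by auto
  obtain n m u where x: "x = p_qp ^ n * u / p_qp ^ m" "u \<in> Zp" "u \<noteq> 0" "inverse u \<in> Zp"
    using qp_eq_p_power_mult_unit[OF \<open>x \<noteq> 0\<close>] by blast
  obtain n' m' u' where y: "y = p_qp ^ n' * u' / p_qp ^ m'" "u' \<in> Zp" "u' \<noteq> 0" "inverse u' \<in> Zp"
    using qp_eq_p_power_mult_unit[OF \<open>y \<noteq> 0\<close>] by blast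
  \<comment> \<open>The valuations \<open>n - m\<close> and \<open>n' - m'\<close> are compared
    after adding \<open>m + m'\<close>, so that the subtraction of natural numbers in the exponent
    is exact.\<close>
  have *: "p_qp ^ n * u / p_qp ^ m = p_qp ^ (n + m' - (n' + m)) * u * inverse u' * (p_qp ^ n' * u' / p_qp ^ m')"
    if "n' + m \<le> n + m'" "u' \<noteq> 0" for n m n' m' and u u' :: "'p qp"
  proof -
    have "p_qp ^ n * p_qp ^ m' = (p_qp ^ (n + m' - (n' + m)) * p_qp ^ (n' + m) :: 'p qp)"
      using that by (simp flip: power_add)
    then show ?thesis using that by (simp add: field_simps power_add)
  qed
  show ?thesis
  proof (cases "n' + m \<le> n + m'")
    case True
    show ?thesis
      by (rule disjI1, rule bexI, unfold x(1) y(1), rule *[OF True y(3)])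
        (intro Zp_mult p_qp_power_Zp x y)
  next
    case False
    then have le: "n + m' \<le> n' + m" by simp
    show ?thesis
      by (rule disjI2, rule bexI, unfold x(1) y(1), rule *[OF le x(3)])
        (intro Zp_mult p_qp_power_Zp x y)
  qed
qed

text \<open>All increments are integral, so after subtraction of \<open>c 0\<close> the sequence
  lies in \<open>Zp\<close>, where \<open>zp_complete\<close> applies.\<close>

lemma qp_complete:
  fixes c :: "nat \<Rightarrow> 'p :: prime_card qp"
  assumes "\<And>n. (c (Suc n) - c n) / p_qp ^ n \<in> Zp"
  shows "\<exists>d. \<forall>n. (d - c n) / p_qp ^ n \<in> Zp"
proof -
  have "\<exists>r\<in>Zp. c (Suc n) - c n = p_qp ^ n * r" for n
    by (rule bexI[OF _ assms[of n]]) simp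
  then have step: "\<exists>r. c (Suc n) - c n = p_qp ^ n * Fract r 1" for n
    unfolding Zp_def by auto
  have "c n - c 0 \<in> Zp" for n
  proof (induction n)
    case (Suc n)
    have "c (Suc n) - c 0 = (c n - c 0) + p_qp ^ n * ((c (Suc n) - c n) / p_qp ^ n)" by simp
    also have "\<dots> \<in> Zp" by (intro Zp_add Zp_mult Suc.IH p_qp_power_Zp assms)
    finally show ?case .
  qed simp
  then have "\<exists>a. c n - c 0 = Fract a 1" for n unfolding Zp_def by blast
  then obtain a where a: "\<And>n. c n - c 0 = Fract (a n) 1" by metis
  have "of_nat (CARD('p) ^ n) dvd a (Suc n) - a n" for n
  proof -
    obtain r where "c (Suc n) - c n = p_qp ^ n * Fract r 1" using step by blast
    moreover have "c (Suc n) - c n = Fract (a (Suc n) - a n) 1"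
      using a[of n] a[of "Suc n"] by (simp add: algebra_simps flip: diff_fract)
    ultimately have "a (Suc n) - a n = of_nat (CARD('p) ^ n) * r"
      unfolding p_qp_power by (simp add: eq_fract)
    then show ?thesis by (rule dvdI)
  qed
  from zp_complete[OF this] obtain b where b: "\<And>n. of_nat (CARD('p) ^ n) dvd b - a n" by blast
  have "(Fract b 1 + c 0 - c n) / p_qp ^ n \<in> Zp" for n
  proof -
    obtain r where r: "b - a n = of_nat (CARD('p) ^ n) * r" using b[of n] ..
    have "Fract b 1 + c 0 - c n = Fract (b - a n) 1"
      using a[of n] by (simp add: algebra_simps flip: diff_fract)
    also have "\<dots> = p_qp ^ n * Fract r 1" unfolding p_qp_power r by simp
    finally show ?thesis unfolding Zp_def by simp
  qed
  then show ?thesis by blast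
qed

section \<open>Homomorphisms into the quotient by \<open>Zp\<close> and separation of
  submodules\<close>

text \<open>
  A submodule \<open>M\<close> of \<open>V \<times> \<rat>\<^sub>p\<close> in which \<open>(0, t)\<close> occurs only for integral \<open>t\<close> is the graph of a
  homomorphism from a submodule of \<open>V\<close> to \<open>\<rat>\<^sub>p / \<int>\<^sub>p\<close>.  It extends to the
  reduction of a linear functional; completeness enters when the domain contains all \<open>p\<^sup>-\<^sup>n\<close>.
\<close>

lemma Zp_hom_extend_line:
  fixes M :: "('p :: prime_card qp \<times> 'p qp) set"
  assumes add: "\<And>x t x' t'. (x, t) \<in> M \<Longrightarrow> (x', t') \<in> M \<Longrightarrow> (x + x', t + t') \<in> M"
    and scale: "\<And>r x t. r \<in> Zp \<Longrightarrow> (x, t) \<in> M \<Longrightarrow> (r * x, r * t) \<in> M"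
    and triv: "\<And>t. (0, t) \<in> M \<Longrightarrow> t \<in> Zp"
  shows "\<exists>c. \<forall>(x, t)\<in>M. t - c * x \<in> Zp"
proof -
  \<comment> \<open>The first entry of a pair in \<open>M\<close> fixes the second up to
    \<open>Zp\<close>, compatibly with integral multiples.\<close>
  have dep: "t - r * t' \<in> Zp" if "(x, t) \<in> M" "(x', t') \<in> M" "r \<in> Zp" "x = r * x'" for x t x' t' r
    using add[OF that(1) scale[OF Zp_uminus[OF that(3)] that(2)]] that(4) triv by simp
  \<comment> \<open>When the domain is generated by \<open>x\<close>, the slope is
    \<open>t / x\<close>. For \<open>x = 0\<close> the division yields 0 and \<open>triv\<close>
    covers the only point of the domain.\<close>
  have cyclic: ?thesis if xt: "(x, t) \<in> M" and gen: "\<And>x' t'. (x', t') \<in> M \<Longrightarrow> \<exists>r\<in>Zp. x' = r * x"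
    for x t
  proof (rule exI[of _ "t / x"], clarify)
    fix x' t' assume xt': "(x', t') \<in> M"
    then obtain r where r: "r \<in> Zp" "x' = r * x" using gen by blast
    show "t' - t / x * x' \<in> Zp"
    proof (cases "x = 0")
      case True then show ?thesis using xt' r triv by simp
    next
      case False then show ?thesis using dep[OF xt' xt r] r by (simp add: mult.commute)
    qed
  qed
  show ?thesis
  proof (cases "\<forall>n. \<exists>t. (1 / p_qp ^ n, t) \<in> M")
    case True
    then obtain t where t: "\<And>n. (1 / p_qp ^ n, t n) \<in> M" by metis
    \<comment> \<open>The slope read off at \<open>1 / p^n\<close>. It is determined modulo
      \<open>p^n\<close>, so these slopes converge, and the limit \<open>d\<close> works on the
      whole domain.\<close>
    define c where "c n = t n * p_qp ^ n" for n
    have "(c (Suc n) - c n) / p_qp ^ n \<in> Zp" for n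
    proof -
      have "t n - p_qp * t (Suc n) \<in> Zp"
        by (rule dep[OF t t]) (use p_qp_power_Zp[of 1] in auto)
      then have "- (t n - p_qp * t (Suc n)) \<in> Zp" by (rule Zp_uminus)
      moreover have "- (t n - p_qp * t (Suc n)) = (c (Suc n) - c n) / p_qp ^ n"
        by (simp add: c_def divide_simps) (simp add: algebra_simps)
      ultimately show ?thesis by simp
    qed
    from qp_complete[OF this] obtain d where d: "\<And>n. (d - c n) / p_qp ^ n \<in> Zp" by blast
    show ?thesis
    proof (rule exI[of _ d], clarify)
      fix x s assume xs: "(x, s) \<in> M"
      obtain n r where r: "x = r / p_qp ^ n" "r \<in> Zp" by (rule qp_eq_Zp_div_p_power)
      have "s - r * t n \<in> Zp" by (rule dep[OF xs t r(2)]) (simp add: r)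
      moreover have "r * ((d - c n) / p_qp ^ n) \<in> Zp" by (rule Zp_mult[OF r(2) d])
      ultimately have "(s - r * t n) - r * ((d - c n) / p_qp ^ n) \<in> Zp" by (rule Zp_diff)
      moreover have "(s - r * t n) - r * ((d - c n) / p_qp ^ n) = s - d * x"
        by (simp add: r c_def field_simps)
      ultimately show "s - d * x \<in> Zp" by (rule back_subst[where P = "\<lambda>y. y \<in> Zp"])
    qed
  next
    case False
    then obtain N where N: "\<And>t. (1 / p_qp ^ N, t) \<notin> M" by blast
    \<comment> \<open>As \<open>1 / p^N\<close> is outside the domain, it is no integral multiple of
      an element of the domain; by \<open>Zp_total\<close> every such element is an integral
      multiple of \<open>1 / p^N\<close>.\<close>
    have unit_form: "\<exists>n u. x = u * (p_qp ^ n / p_qp ^ N) \<and> u \<in> Zp \<and> (p_qp ^ n / p_qp ^ N, inverse u * t) \<in> M"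
      if "(x, t) \<in> M" "x \<noteq> 0" for x t
    proof -
      have "\<not> (\<exists>r\<in>Zp. 1 / p_qp ^ N = r * x)" using N scale that by metis
      then obtain r where r: "r \<in> Zp" "x = r * (1 / p_qp ^ N)"
        using Zp_total[of x "1 / p_qp ^ N"] by blast
      have "r \<noteq> 0" using r(2) that(2) by auto
      then obtain n u where u: "r = p_qp ^ n * u" "u \<in> Zp" "u \<noteq> 0" "inverse u \<in> Zp"
        using Zp_eq_p_power_mult_unit[OF r(1)] \<open>r \<noteq> 0\<close> by blast
      have "p_qp ^ n / p_qp ^ N = inverse u * x" using r u by (simp add: field_simps)
      then have "(p_qp ^ n / p_qp ^ N, inverse u * t) \<in> M" using scale[OF u(4) that(1)] by simp
      then show ?thesis using r u by (auto intro!: exI[of _ n] exI[of _ u])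
    qed
    show ?thesis
    proof (cases "\<exists>n t. (p_qp ^ n / p_qp ^ N, t) \<in> M")
      case True
      \<comment> \<open>The least exponent belongs to an element of least valuation, which generates
        the domain.\<close>
      define n where "n = (LEAST n. \<exists>t. (p_qp ^ n / p_qp ^ N, t) \<in> M)"
      obtain t where t: "(p_qp ^ n / p_qp ^ N, t) \<in> M"
        using LeastI_ex[OF True] unfolding n_def by blast
      show ?thesis
      proof (rule cyclic[OF t])
        fix x' t' assume xt': "(x', t') \<in> M"
        show "\<exists>r\<in>Zp. x' = r * (p_qp ^ n / p_qp ^ N)"
        proof (cases "x' = 0")
          case False
          then obtain n' u where u: "x' = u * (p_qp ^ n' / p_qp ^ N)" "u \<in> Zp"
            "(p_qp ^ n' / p_qp ^ N, inverse u * t') \<in> M" using unit_form[OF xt'] by blast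
          have "n \<le> n'" unfolding n_def by (rule Least_le) (use u in blast)
          then have "p_qp ^ n' = (p_qp ^ (n' - n) * p_qp ^ n :: 'p qp)" by (simp flip: power_add)
          then show ?thesis using u
            by (intro bexI[of _ "u * p_qp ^ (n' - n)"] Zp_mult p_qp_power_Zp) simp_all
        qed (auto intro: bexI[of _ 0])
      qed
    next
      case False
      then have "x = 0" if "(x, t) \<in> M" for x t using unit_form[OF that] by blast
      then show ?thesis using triv by (intro exI[of _ 0]) auto
    qed
  qed
qed

text \<open>Induction on the coordinates. Elements of \<open>M\<close> whose coordinates in
  \<open>I\<close> vanish live on the line of \<open>j\<close> and determine a slope
  \<open>d\<close> there. Subtracting \<open>d * x j\<close> from the values makes them integral
  wherever the coordinates in \<open>I\<close> vanish, as the induction hypothesis requires.\<close>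

lemma Zp_hom_extend:
  fixes M :: "(('i \<Rightarrow> 'p :: prime_card qp) \<times> 'p qp) set"
  assumes "finite I"
    and "\<And>x t x' t'. (x, t) \<in> M \<Longrightarrow> (x', t') \<in> M \<Longrightarrow> (\<lambda>i. x i + x' i, t + t') \<in> M"
    and "\<And>r x t. r \<in> Zp \<Longrightarrow> (x, t) \<in> M \<Longrightarrow> (\<lambda>i. r * x i, r * t) \<in> M"
    and "\<And>x t. (x, t) \<in> M \<Longrightarrow> \<forall>i\<in>I. x i = 0 \<Longrightarrow> t \<in> Zp"
  shows "\<exists>c. \<forall>(x, t)\<in>M. t - (\<Sum>i\<in>I. c i * x i) \<in> Zp"
  using assms
proof (induction I arbitrary: M rule: finite_induct)
  case empty
  then show ?case by auto
next
  case (insert j I)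
  define L where "L = {(x j, t) | x t. (x, t) \<in> M \<and> (\<forall>i\<in>I. x i = 0)}"
  have "\<exists>d. \<forall>(y, t)\<in>L. t - d * y \<in> Zp"
  proof (rule Zp_hom_extend_line)
    fix y t y' t' assume "(y, t) \<in> L" "(y', t') \<in> L"
    then show "(y + y', t + t') \<in> L" unfolding L_def using insert.prems(1) by fastforce
  next
    fix r :: "'p qp" and y t assume "r \<in> Zp" "(y, t) \<in> L"
    then show "(r * y, r * t) \<in> L" unfolding L_def using insert.prems(2) by fastforce
  next
    fix t assume "(0, t) \<in> L"
    then show "t \<in> Zp" unfolding L_def using insert.prems(3) by auto
  qed
  then obtain d where d: "\<And>x t. (x, t) \<in> M \<Longrightarrow> \<forall>i\<in>I. x i = 0 \<Longrightarrow> t - d * x j \<in> Zp"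
    unfolding L_def by blast
  define M' where "M' = {(x, t - d * x j) | x t. (x, t) \<in> M}"
  have "\<exists>c. \<forall>(x, t)\<in>M'. t - (\<Sum>i\<in>I. c i * x i) \<in> Zp"
  proof (rule insert.IH)
    fix x t x' t' assume "(x, t) \<in> M'" "(x', t') \<in> M'"
    then obtain s s' where s: "(x, s) \<in> M" "(x', s') \<in> M" "t = s - d * x j" "t' = s' - d * x' j"
      unfolding M'_def by blast
    have "t + t' = s + s' - d * (x j + x' j)" unfolding s(3,4) by (simp add: algebra_simps)
    then show "(\<lambda>i. x i + x' i, t + t') \<in> M'"
      unfolding M'_def using insert.prems(1)[OF s(1,2)] by blast
  next
    fix r :: "'p qp" and x t assume "r \<in> Zp" "(x, t) \<in> M'"
    then show "(\<lambda>i. r * x i, r * t) \<in> M'" unfolding M'_def using insert.prems(2)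
      by (force simp: algebra_simps)
  next
    fix x t assume "(x, t) \<in> M'" "\<forall>i\<in>I. x i = 0"
    then show "t \<in> Zp" unfolding M'_def using d by auto
  qed
  then obtain c where c: "\<And>x t. (x, t) \<in> M \<Longrightarrow> t - d * x j - (\<Sum>i\<in>I. c i * x i) \<in> Zp"
    unfolding M'_def by blast
  have eq: "t - (\<Sum>i\<in>insert j I. (c(j := d)) i * x i) = t - d * x j - (\<Sum>i\<in>I. c i * x i)" for x t
  proof -
    have "(\<Sum>i\<in>I. (c(j := d)) i * x i) = (\<Sum>i\<in>I. c i * x i)"
      using insert.hyps by (intro sum.cong) auto
    then show ?thesis using insert.hyps by simp
  qed
  show ?case by (rule exI[of _ "c(j := d)"], unfold eq) (use c in auto)
qed

text \<open>On \<open>S + Zp e\<close> take the homomorphism into the quotient by \<open>Zp\<close>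
  that kills \<open>S\<close> and sends \<open>e\<close> to \<open>1 / p\<close>. Its extension to a
  linear functional is integral on \<open>S\<close> but not at \<open>e\<close>.\<close>

lemma zp_submodule_separation:
  fixes S :: "('i \<Rightarrow> 'p :: prime_card qp) set"
  assumes "finite I" "zp_submodule (coord_space I) S" "e \<in> coord_space I" "e \<notin> S"
  shows "\<exists>c. (\<forall>s\<in>S. (\<Sum>i\<in>I. c i * s i) \<in> Zp) \<and> (\<Sum>i\<in>I. c i * e i) \<notin> Zp"
proof -
  have S0: "(\<lambda>_. 0) \<in> S" and Sadd: "\<And>v w. v \<in> S \<Longrightarrow> w \<in> S \<Longrightarrow> (\<lambda>i. v i + w i) \<in> S"
    and Sscale: "\<And>c v. c \<in> Zp \<Longrightarrow> v \<in> S \<Longrightarrow> (\<lambda>i. c * v i) \<in> S"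
    and Ssub: "\<And>v i. v \<in> S \<Longrightarrow> i \<notin> I \<Longrightarrow> v i = 0"
    using assms(2) unfolding zp_submodule_def coord_space_def by auto
  have e0: "i \<notin> I \<Longrightarrow> e i = 0" for i using assms(3) unfolding coord_space_def by auto
  define M where "M = {(\<lambda>i. s i + r * e i, r / p_qp) | s r. s \<in> S \<and> r \<in> Zp}"
  have "\<exists>c. \<forall>(x, t)\<in>M. t - (\<Sum>i\<in>I. c i * x i) \<in> Zp"
  proof (rule Zp_hom_extend[OF assms(1)])
    fix x t x' t' assume "(x, t) \<in> M" "(x', t') \<in> M"
    then obtain s r s' r' where *: "x = (\<lambda>i. s i + r * e i)" "t = r / p_qp" "s \<in> S" "r \<in> Zp"
      "x' = (\<lambda>i. s' i + r' * e i)" "t' = r' / p_qp" "s' \<in> S" "r' \<in> Zp"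
      unfolding M_def by blast
    show "(\<lambda>i. x i + x' i, t + t') \<in> M" unfolding M_def
      by (rule CollectI, rule exI[of _ "\<lambda>i. s i + s' i"], rule exI[of _ "r + r'"])
        (auto simp: * algebra_simps add_divide_distrib intro: Sadd Zp_add)
  next
    fix r :: "'p qp" and x t assume "r \<in> Zp" "(x, t) \<in> M"
    then obtain s r' where *: "x = (\<lambda>i. s i + r' * e i)" "t = r' / p_qp" "s \<in> S" "r' \<in> Zp"
      unfolding M_def by blast
    show "(\<lambda>i. r * x i, r * t) \<in> M" unfolding M_def
      by (rule CollectI, rule exI[of _ "\<lambda>i. r * s i"], rule exI[of _ "r * r'"])
        (auto simp: * \<open>r \<in> Zp\<close> algebra_simps intro: Sscale Zp_mult)
  next
    fix x t assume "(x, t) \<in> M" and x0: "\<forall>i\<in>I. x i = 0"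
    then obtain s r where *: "x = (\<lambda>i. s i + r * e i)" "t = r / p_qp" "s \<in> S" "r \<in> Zp"
      unfolding M_def by blast
    have re: "r * e i = (- 1) * s i" for i
      using x0 *(1) e0[of i] Ssub[OF *(3), of i] by (cases "i \<in> I") (auto simp: add_eq_0_iff)
    \<comment> \<open>Well-definedness of the homomorphism: a unit \<open>r\<close> would put
      \<open>e\<close> itself into \<open>S\<close>, so \<open>p\<close> divides \<open>r\<close>
      and the value \<open>r / p\<close> is integral.\<close>
    have "(\<lambda>i. r * e i) \<in> S" unfolding re by (intro Sscale Zp_uminus Zp_1 *)
    show "t \<in> Zp"
    proof (cases "r = 0")
      case False
      then obtain n u where u: "r = p_qp ^ n * u" "u \<in> Zp" "u \<noteq> 0" "inverse u \<in> Zp"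
        using Zp_eq_p_power_mult_unit[OF *(4)] by blast
      show ?thesis
      proof (cases n)
        case 0
        have "(\<lambda>i. inverse u * (r * e i)) \<in> S" by (rule Sscale[OF u(4)]) fact
        moreover have "inverse u * (r * e i) = e i" for i
          unfolding u(1) 0 using u(3) by simp
        then have "(\<lambda>i. inverse u * (r * e i)) = e" by (rule ext)
        ultimately have "e \<in> S" by (rule back_subst[where P = "\<lambda>x. x \<in> S"])
        then have False using assms(4) by blast
        then show ?thesis ..
      next
        case (Suc n')
        then have "t = p_qp ^ n' * u" by (simp add: * u)
        then show ?thesis by (auto intro: Zp_mult p_qp_power_Zp u)
      qed
    qed (simp add: *)
  qed
  then obtain c where cM: "\<forall>(x, t)\<in>M. t - (\<Sum>i\<in>I. c i * x i) \<in> Zp" by blast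
  have c: "r / p_qp - (\<Sum>i\<in>I. c i * (s i + r * e i)) \<in> Zp" if "s \<in> S" "r \<in> Zp" for s r
  proof -
    have "(\<lambda>i. s i + r * e i, r / p_qp) \<in> M" unfolding M_def using that by blast
    from bspec[OF cM this] show ?thesis unfolding prod.case .
  qed
  have "(\<Sum>i\<in>I. c i * s i) \<in> Zp" if "s \<in> S" for s
    using Zp_uminus[OF c[OF that Zp_0]] by simp
  moreover have "(\<Sum>i\<in>I. c i * e i) \<notin> Zp"
  proof
    assume "(\<Sum>i\<in>I. c i * e i) \<in> Zp"
    with c[OF S0 Zp_1] have "1 / p_qp - (\<Sum>i\<in>I. c i * e i) + (\<Sum>i\<in>I. c i * e i) \<in> Zp"
      by (intro Zp_add) auto
    then show False using inverse_p_qp_notin_Zp[where 'p = 'p] by simp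
  qed
  ultimately show ?thesis by blast
qed

section \<open>The monoid of finitary matrices\<close>

text \<open>A square block is used instead of the set of exceptional entries because, for a fixed
  \<open>J\<close> inside \<open>I\<close>, such matrices are closed under products and
  transposition and act as finite matrices on \<open>J\<close>.\<close>

definition identity_off :: "'i set \<Rightarrow> 'i set \<Rightarrow> ('i, 'p :: prime_card) qmat \<Rightarrow> bool" where
  "identity_off I J g \<longleftrightarrow> (\<forall>a b. (a, b) \<notin> J \<times> J \<longrightarrow> g a b = one_mat I a b)"

lemma identity_offD: "identity_off I J g \<Longrightarrow> a \<notin> J \<or> b \<notin> J \<Longrightarrow> g a b = one_mat I a b"
  unfolding identity_off_def by auto

lemma identity_off_mono: "identity_off I J g \<Longrightarrow> J \<subseteq> J' \<Longrightarrow> identity_off I J' g"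
  unfolding identity_off_def by blast

lemma identity_off_transp: "identity_off I J g \<Longrightarrow> identity_off I J (mat_transp g)"
  unfolding identity_off_def mat_transp_def one_mat_def by auto

lemma finitary_iff: "finitary I g \<longleftrightarrow> (\<exists>J. finite J \<and> J \<subseteq> I \<and> identity_off I J g)"
proof
  assume g: "finitary I g"
  define D where "D = {(a, b). g a b - one_mat I a b \<noteq> 0}"
  have "D \<subseteq> I \<times> I" using g unfolding D_def finitary_def one_mat_def by auto
  moreover have "finite D" using g unfolding D_def finitary_def by blast
  \<comment> \<open>The block consists of the row and the column indices of all exceptional
    entries.\<close>
  moreover have "identity_off I (fst ` D \<union> snd ` D) g"
    unfolding identity_off_def D_def by (force simp: image_iff)
  ultimately show "\<exists>J. finite J \<and> J \<subseteq> I \<and> identity_off I J g"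
    by (intro exI[of _ "fst ` D \<union> snd ` D"]) auto
next
  assume "\<exists>J. finite J \<and> J \<subseteq> I \<and> identity_off I J g"
  then obtain J where J: "finite J" "J \<subseteq> I" "identity_off I J g" by blast
  have "{(a, b). g a b - one_mat I a b \<noteq> 0} \<subseteq> J \<times> J"
    using identity_offD[OF J(3)] by fastforce
  then have "finite {(a, b). g a b - one_mat I a b \<noteq> 0}"
    by (rule finite_subset) (simp add: J)
  moreover have "g a b = 0" if "(a, b) \<notin> I \<times> I" for a b
  proof -
    have "(a, b) \<notin> J \<times> J" using that J(2) by blast
    then show ?thesis using J(3) that unfolding identity_off_def one_mat_def by auto
  qed
  ultimately show "finitary I g" unfolding finitary_def by blast
qed

text \<open>Turns \<open>Sum_any\<close> into a sum over a finite block, for an arbitrary column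
  \<open>w\<close>; the algebra of finitary matrices below rests on it.\<close>

lemma mat_vec_identity_off:
  assumes "finite J" "J \<subseteq> I" "identity_off I J g"
  shows "mat_vec g w a = (if a \<in> J then \<Sum>b\<in>J. g a b * w b else if a \<in> I then w a else 0)"
proof (cases "a \<in> J")
  case True
  have "{b. g a b * w b \<noteq> 0} \<subseteq> J"
  proof
    fix b assume "b \<in> {b. g a b * w b \<noteq> 0}"
    then show "b \<in> J"
      using identity_offD[OF assms(3), of a b] True by (cases "b \<in> J") (auto simp: one_mat_def split: if_splits)
  qed
  then show ?thesis unfolding mat_vec_def
    by (simp add: Sum_any.expand_superset[OF assms(1)] True)
next
  case False
  then have g: "g a b = one_mat I a b" for b using identity_offD[OF assms(3)] by blast
  have "{b. g a b * w b \<noteq> 0} \<subseteq> {a}" unfolding g by (auto simp: one_mat_def)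
  then have "mat_vec g w a = g a a * w a" unfolding mat_vec_def
    by (subst Sum_any.expand_superset[of "{a}"]) auto
  then show ?thesis using False g by (simp add: one_mat_def)
qed

lemma mat_mul_eq_mat_vec: "mat_mul g h a c = mat_vec g (\<lambda>b. h b c) a"
  unfolding mat_mul_def mat_vec_def ..

lemma identity_off_mat_mul:
  assumes "finite J" "J \<subseteq> I" "identity_off I J g" "identity_off I J h"
  shows "identity_off I J (mat_mul g h)"
  unfolding identity_off_def mat_mul_eq_mat_vec mat_vec_identity_off[OF assms(1-3)]
  using identity_offD[OF assms(4)] assms(2)
  by (auto simp: one_mat_def intro!: sum.neutral)

lemma finitary_common:
  assumes "finitary I g" "finitary I h"
  obtains J where "finite J" "J \<subseteq> I" "identity_off I J g" "identity_off I J h"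
proof -
  obtain J1 J2 where "finite J1" "J1 \<subseteq> I" "identity_off I J1 g"
    "finite J2" "J2 \<subseteq> I" "identity_off I J2 h"
    using assms unfolding finitary_iff by blast
  then show ?thesis
    by (intro that[of "J1 \<union> J2"]) (auto intro: identity_off_mono)
qed

lemma finitary_mat_mul: "finitary I g \<Longrightarrow> finitary I h \<Longrightarrow> finitary I (mat_mul g h)"
  by (meson finitary_common finitary_iff identity_off_mat_mul)

lemma finitary_transp: "finitary I g \<Longrightarrow> finitary I (mat_transp g)"
  unfolding finitary_iff using identity_off_transp by blast

lemma identity_off_one_mat: "identity_off I J (one_mat I)"
  unfolding identity_off_def by simp

lemma finitary_one_mat: "finitary I (one_mat I)"
  unfolding finitary_iff using identity_off_one_mat by blast

text \<open>On a common block the claim is an exchange of finite sums; outside it both matrices act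
  as \<open>one_mat I\<close>. Associativity follows by applying this to the columns of a third
  matrix.\<close>

lemma mat_vec_mat_mul:
  assumes "finitary I g" "finitary I h"
  shows "mat_vec (mat_mul g h) w = mat_vec g (mat_vec h w)"
proof
  fix a
  obtain J where J: "finite J" "J \<subseteq> I" and g: "identity_off I J g" and h: "identity_off I J h"
    using finitary_common[OF assms] .
  note mv = mat_vec_identity_off[OF J]
  show "mat_vec (mat_mul g h) w a = mat_vec g (mat_vec h w) a"
  proof (cases "a \<in> J")
    case True
    have "mat_vec (mat_mul g h) w a = (\<Sum>c\<in>J. (\<Sum>b\<in>J. g a b * h b c) * w c)"
      using True by (simp add: mv[OF identity_off_mat_mul[OF J g h]] mat_mul_eq_mat_vec mv[OF g])
    also have "\<dots> = (\<Sum>c\<in>J. \<Sum>b\<in>J. g a b * h b c * w c)" by (simp add: sum_distrib_right)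
    also have "\<dots> = (\<Sum>b\<in>J. \<Sum>c\<in>J. g a b * h b c * w c)" by (rule sum.swap)
    also have "\<dots> = (\<Sum>b\<in>J. g a b * (\<Sum>c\<in>J. h b c * w c))"
      by (simp add: sum_distrib_left mult.assoc)
    also have "\<dots> = mat_vec g (mat_vec h w) a" using True by (simp add: mv[OF g] mv[OF h])
    finally show ?thesis .
  qed (simp add: mv[OF identity_off_mat_mul[OF J g h]] mv[OF g] mv[OF h])
qed

lemma mat_mul_assoc:
  assumes "finitary I g" "finitary I h"
  shows "mat_mul (mat_mul g h) k = mat_mul g (mat_mul h k)"
  by (intro ext) (simp add: mat_mul_eq_mat_vec mat_vec_mat_mul[OF assms])

lemma mat_vec_one_mat: "mat_vec (one_mat I) w a = (if a \<in> I then w a else 0)"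
  by (simp add: mat_vec_identity_off[where J = "{}" and I = I] identity_off_one_mat)

lemma mat_transp_mat_mul: "mat_transp (mat_mul g h) = mat_mul (mat_transp h) (mat_transp g)"
  unfolding mat_transp_def mat_mul_def by (simp add: mult.commute)

lemma mat_transp_one_mat: "mat_transp (one_mat I) = one_mat I"
  unfolding mat_transp_def one_mat_def by (intro ext) auto

lemma mat_transp_transp [simp]: "mat_transp (mat_transp g) = g"
  unfolding mat_transp_def ..

lemma mat_mul_one_left: "finitary I g \<Longrightarrow> mat_mul (one_mat I) g = g"
  by (intro ext) (auto simp: mat_mul_eq_mat_vec mat_vec_one_mat finitary_def)

lemma mat_mul_one_right: "finitary I g \<Longrightarrow> mat_mul g (one_mat I) = g"
  by (metis finitary_transp mat_mul_one_left mat_transp_mat_mul mat_transp_one_mat mat_transp_transp)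

lemma monoid_finitary_monoid: "Group.monoid (finitary_monoid I)"
  by (rule Group.monoidI)
    (simp_all add: finitary_monoid_def finitary_mat_mul finitary_one_mat mat_mul_assoc
      mat_mul_one_left mat_mul_one_right)

lemma carrier_GL_fin_iff:
  "g \<in> carrier (GL_fin I) \<longleftrightarrow> finitary I g \<and>
    (\<exists>h. finitary I h \<and> mat_mul g h = one_mat I \<and> mat_mul h g = one_mat I)"
  unfolding GL_fin_def units_of_carrier Units_def by (auto simp: finitary_monoid_def)

lemma transp_in_GL_fin: "g \<in> carrier (GL_fin I) \<Longrightarrow> mat_transp g \<in> carrier (GL_fin I)"
proof -
  assume "g \<in> carrier (GL_fin I)"
  then obtain h where h: "finitary I g" "finitary I h"
    "mat_mul g h = one_mat I" "mat_mul h g = one_mat I"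
    unfolding carrier_GL_fin_iff by blast
  have "mat_mul (mat_transp g) (mat_transp h) = one_mat I"
    "mat_mul (mat_transp h) (mat_transp g) = one_mat I"
    unfolding mat_transp_mat_mul[symmetric] h mat_transp_one_mat by (rule refl)+
  then show ?thesis unfolding carrier_GL_fin_iff using h finitary_transp by blast
qed

lemma GL_fin_inv:
  assumes "g \<in> carrier (GL_fin I)"
  shows "finitary I (inv\<^bsub>GL_fin I\<^esub> g)"
    "mat_mul g (inv\<^bsub>GL_fin I\<^esub> g) = one_mat I" "mat_mul (inv\<^bsub>GL_fin I\<^esub> g) g = one_mat I"
proof -
  interpret group "GL_fin I"
    unfolding GL_fin_def by (rule monoid.units_group[OF monoid_finitary_monoid])
  have mult: "x \<otimes>\<^bsub>GL_fin I\<^esub> y = mat_mul x y" and one: "\<one>\<^bsub>GL_fin I\<^esub> = one_mat I" for x y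
    by (simp_all add: GL_fin_def units_of_mult units_of_one finitary_monoid_def)
  show "finitary I (inv\<^bsub>GL_fin I\<^esub> g)"
    using inv_closed[OF assms] unfolding carrier_GL_fin_iff by blast
  show "mat_mul g (inv\<^bsub>GL_fin I\<^esub> g) = one_mat I" "mat_mul (inv\<^bsub>GL_fin I\<^esub> g) g = one_mat I"
    using r_inv[OF assms] l_inv[OF assms] by (simp_all add: mult one)
qed

text \<open>On columns supported in \<open>I\<close> the matrix \<open>one_mat I\<close> acts as the
  identity, so \<open>g\<close> and its inverse cancel.\<close>

lemma mat_vec_inv_iff:
  assumes "g \<in> carrier (GL_fin I)" "w \<in> coord_space I" "w' \<in> coord_space I"
  shows "w' = mat_vec (inv\<^bsub>GL_fin I\<^esub> g) w \<longleftrightarrow> w = mat_vec g w'"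
proof -
  have g: "finitary I g" using assms(1) unfolding carrier_GL_fin_iff by blast
  have one: "mat_vec (one_mat I) v = v" if "v \<in> coord_space I" for v :: "_ \<Rightarrow> 'b qp"
    using that by (auto simp: mat_vec_one_mat coord_space_def)
  note inv = GL_fin_inv[OF assms(1)]
  show ?thesis
    using mat_vec_mat_mul[OF g inv(1), of w] mat_vec_mat_mul[OF inv(1) g, of w']
    unfolding inv(2,3) one[OF assms(2)] one[OF assms(3)] by metis
qed

section \<open>The relation of a matrix\<close>

lemma mat_vec_add:
  assumes "finitary I g"
  shows "mat_vec g (\<lambda>b. w b + w' b) a = mat_vec g w a + mat_vec g w' a"
proof -
  obtain J where J: "finite J" "J \<subseteq> I" "identity_off I J g" using assms unfolding finitary_iff by blast
  show ?thesis by (simp add: mat_vec_identity_off[OF J] distrib_left sum.distrib)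
qed

lemma mat_vec_scale:
  assumes "finitary I g"
  shows "mat_vec g (\<lambda>b. c * w b) a = c * mat_vec g w a"
proof -
  obtain J where J: "finite J" "J \<subseteq> I" "identity_off I J g" using assms unfolding finitary_iff by blast
  show ?thesis by (simp add: mat_vec_identity_off[OF J] sum_distrib_left mult.left_commute)
qed

lemma mat_vec_0 [simp]: "mat_vec g (\<lambda>_. 0) = (\<lambda>_. 0)"
  unfolding mat_vec_def by simp

section \<open>Symplectic forms and the criterion for membership in a self-dual submodule\<close>

lemma zp_submoduleD:
  assumes "zp_submodule V R"
  shows "R \<subseteq> V" "(\<lambda>_. 0) \<in> R" "v \<in> R \<Longrightarrow> w \<in> R \<Longrightarrow> (\<lambda>i. v i + w i) \<in> R"
    "c \<in> Zp \<Longrightarrow> v \<in> R \<Longrightarrow> (\<lambda>i. c * v i) \<in> R"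
  using assms unfolding zp_submodule_def by simp_all

lemma zp_submodule_sum:
  assumes "zp_submodule V R" "\<And>i. i \<in> A \<Longrightarrow> f i \<in> R" "\<And>i. i \<in> A \<Longrightarrow> c i \<in> Zp"
  shows "(\<lambda>l. \<Sum>i\<in>A. c i * f i l) \<in> R"
  using assms(2,3)
proof (induction A rule: infinite_finite_induct)
  case (insert i A)
  have "(\<lambda>l. c i * f i l + (\<Sum>i\<in>A. c i * f i l)) \<in> R"
    using insert by (intro zp_submoduleD(3)[OF assms(1)] zp_submoduleD(4)[OF assms(1)]) auto
  then show ?case using insert.hyps by simp
qed (use zp_submoduleD(2)[OF assms(1)] in simp_all)

lemma sympl_form_add_left:
  "sympl_form n (\<lambda>i. u i + u' i) w = sympl_form n u w + sympl_form n u' w"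
  unfolding sympl_form_def by (simp add: algebra_simps sum.distrib sum_subtractf)

lemma sympl_form_scale_left: "sympl_form n (\<lambda>i. c * u i) w = c * sympl_form n u w"
  unfolding sympl_form_def by (simp add: algebra_simps sum_distrib_left)

lemma sympl_form_swap: "sympl_form n u w = - sympl_form n w u"
  unfolding sympl_form_def by (simp add: mult.commute flip: sum_negf)

lemma sympl_form_add_right:
  "sympl_form n w (\<lambda>i. u i + u' i) = sympl_form n w u + sympl_form n w u'"
  using sympl_form_add_left[of n u u' w] by (simp add: sympl_form_swap[of n w])

lemma sympl_form_scale_right: "sympl_form n w (\<lambda>i. c * u i) = c * sympl_form n w u"
  using sympl_form_scale_left[of n c u w] by (simp add: sympl_form_swap[of n w])

lemma sympl_form_self [simp]: "sympl_form n u u = 0"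
  unfolding sympl_form_def by (simp add: mult.commute)

lemma sympl_form_0 [simp]: "sympl_form n (\<lambda>_. 0) w = 0" "sympl_form n w (\<lambda>_. 0) = 0"
  unfolding sympl_form_def by simp_all

lemma sympl_space_iff:
  "u \<in> sympl_space n \<longleftrightarrow> (\<forall>i\<ge>n. u (Inl i) = 0 \<and> u (Inr i) = 0)"
  unfolding sympl_space_def coord_space_def mem_Collect_eq split_sum_all
  by (auto simp: Plus_def image_iff)

lemma self_dualD:
  assumes "self_dual V B R"
  shows "zp_submodule V R" "R \<subseteq> V" "(\<lambda>_. 0) \<in> R" "v \<in> R \<Longrightarrow> w \<in> R \<Longrightarrow> B v w \<in> Zp"
  using assms unfolding self_dual_def isotropic_def zp_submodule_def by blast+

text \<open>The form is alternating, so \<open>Q + Zp w\<close> is again isotropic, and maximality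
  forces it to equal \<open>Q\<close>.\<close>

lemma self_dual_memI:
  assumes sd: "self_dual (sympl_space n) (sympl_form n) Q"
    and w: "w \<in> sympl_space n" and wQ: "\<And>q. q \<in> Q \<Longrightarrow> sympl_form n w q \<in> Zp"
  shows "w \<in> Q"
proof -
  note Q = self_dualD[OF sd]
  note Qadd = zp_submoduleD(3)[OF Q(1)] and Qscale = zp_submoduleD(4)[OF Q(1)]
  define R where "R = {(\<lambda>i. q i + c * w i) | q c. q \<in> Q \<and> c \<in> Zp}"
  have "zp_submodule (sympl_space n) R"
    unfolding zp_submodule_def
  proof (intro conjI ballI)
    show "R \<subseteq> sympl_space n"
      using Q(2) w unfolding R_def by (fastforce simp: sympl_space_iff)
    show "(\<lambda>_. 0) \<in> R"
      unfolding R_def using Q(3) by (intro CollectI exI[of _ "\<lambda>_. 0"] exI[of _ 0]) simp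
  next
    fix v v' assume "v \<in> R" "v' \<in> R"
    then obtain q c q' c' where *: "v = (\<lambda>i. q i + c * w i)" "q \<in> Q" "c \<in> Zp"
      "v' = (\<lambda>i. q' i + c' * w i)" "q' \<in> Q" "c' \<in> Zp" unfolding R_def by blast
    show "(\<lambda>i. v i + v' i) \<in> R" unfolding R_def
      by (rule CollectI, rule exI[of _ "\<lambda>i. q i + q' i"], rule exI[of _ "c + c'"])
        (simp add: * Qadd Zp_add algebra_simps)
  next
    fix c v assume c: "c \<in> (Zp :: 'a qp set)" and "v \<in> R"
    then obtain q c' where *: "v = (\<lambda>i. q i + c' * w i)" "q \<in> Q" "c' \<in> Zp"
      unfolding R_def by blast
    show "(\<lambda>i. c * v i) \<in> R" unfolding R_def
      by (rule CollectI, rule exI[of _ "\<lambda>i. c * q i"], rule exI[of _ "c * c'"])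
        (simp add: * Qscale Zp_mult c algebra_simps)
  qed
  moreover have "sympl_form n v v' \<in> Zp" if "v \<in> R" "v' \<in> R" for v v'
  proof -
    obtain q c q' c' where *: "v = (\<lambda>i. q i + c * w i)" "q \<in> Q" "c \<in> Zp"
      "v' = (\<lambda>i. q' i + c' * w i)" "q' \<in> Q" "c' \<in> Zp" using \<open>v \<in> R\<close> \<open>v' \<in> R\<close> unfolding R_def by blast
    have "sympl_form n v v' = sympl_form n q q' - c' * sympl_form n w q + c * sympl_form n w q'"
      unfolding * sympl_form_add_left sympl_form_add_right sympl_form_scale_left sympl_form_scale_right
      by (simp add: sympl_form_swap[of n q w])
    also have "\<dots> \<in> Zp" by (intro Zp_add Zp_diff Zp_mult Q(4) wQ *)
    finally show ?thesis .
  qed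
  ultimately have "isotropic (sympl_space n) (sympl_form n) R" unfolding isotropic_def by blast
  moreover have "q \<in> R" if "q \<in> Q" for q
    unfolding R_def using that by (intro CollectI exI[of _ q] exI[of _ 0]) simp
  ultimately have "R = Q" using sd unfolding self_dual_def by blast
  moreover have "w \<in> R"
    unfolding R_def using Q(3)
    by (intro CollectI exI[of _ "\<lambda>_. 0"] exI[of _ 1]) simp
  ultimately show ?thesis by simp
qed

section \<open>Columns of the finite block and their coordinate vectors\<close>

lemma finite_idx_set_fin [simp]: "finite (idx_set_fin \<alpha> k m)"
  unfolding idx_set_fin_def by simp

lemma idx_set_fin_subset: "idx_set_fin \<alpha> k m \<subseteq> idx_set \<alpha> k"
  unfolding idx_set_fin_def idx_set_def by auto

lemma idx_set_fin_simps [simp]: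
  "Inl a \<in> idx_set_fin \<alpha> k m \<longleftrightarrow> a < \<alpha>" "Inr (j, i) \<in> idx_set_fin \<alpha> k m \<longleftrightarrow> j < k \<and> i < m"
  unfolding idx_set_fin_def by auto

lemma idx_set_simps [simp]:
  "Inl a \<in> idx_set \<alpha> k \<longleftrightarrow> a < \<alpha>" "Inr (j, i) \<in> idx_set \<alpha> k \<longleftrightarrow> j < k"
  unfolding idx_set_def by auto

lemma sum_idx_set_fin:
  "(\<Sum>a\<in>idx_set_fin \<alpha> k m. f a) = (\<Sum>a<\<alpha>. f (Inl a)) + (\<Sum>i<m. \<Sum>j<k. f (Inr (j, i)))"
proof -
  have "(\<Sum>a\<in>idx_set_fin \<alpha> k m. f a) = (\<Sum>a<\<alpha>. f (Inl a)) + (\<Sum>b\<in>{..<k} \<times> {..<m}. f (Inr b))"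
    unfolding idx_set_fin_def by (subst sum.Plus) (simp_all add: o_def)
  also have "(\<Sum>b\<in>{..<k} \<times> {..<m}. f (Inr b)) = (\<Sum>j<k. \<Sum>i<m. f (Inr (j, i)))"
    by (simp add: sum.cartesian_product)
  finally show ?thesis by (subst sum.swap)
qed

lemma col_simps [simp]:
  "col_plus u x (Inl a) = u (Inl a)" "col_plus u x (Inr (j, i)) = x i (Inl j)"
  "col_minus u x (Inl a) = u (Inr a)" "col_minus u x (Inr (j, i)) = x i (Inr j)"
  unfolding col_plus_def col_minus_def by simp_all

lemma idx_cases:
  obtains a where "b = Inl a" | j i where "b = (Inr (j, i) :: idx)"
  by (cases b) auto

text \<open>Separates the contribution of the outer vectors in \<open>\<V>\<close> from that of the
  inner ones, which \<open>Q\<close> and \<open>T\<close> control.\<close>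

lemma col_sympl_form:
  "(\<Sum>a\<in>idx_set_fin \<alpha> k m. col_plus u x a * col_minus u' x' a - col_minus u x a * col_plus u' x' a)
    = sympl_form \<alpha> u u' + (\<Sum>i<m. sympl_form k (x i) (x' i))"
  unfolding sum_idx_set_fin sympl_form_def by simp

text \<open>Used to read the separating functional as vectors of \<open>\<V>\<close> and
  \<open>\<H>\<close>; that the latter lie in \<open>Q\<close> or \<open>T\<close> is proved
  afterwards.\<close>

lemma col_surj:
  assumes "P \<in> coord_space (idx_set_fin \<alpha> k m)" "N \<in> coord_space (idx_set_fin \<alpha> k m)"
  obtains u x where "u \<in> sympl_space \<alpha>" "\<And>i. x i \<in> sympl_space k" "\<And>i. i \<ge> m \<Longrightarrow> x i = (\<lambda>_. 0)"
    "col_plus u x = P" "col_minus u x = N"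
proof (rule that)
  let ?u = "case_sum (\<lambda>a. P (Inl a)) (\<lambda>a. N (Inl a))"
  let ?x = "\<lambda>i. case_sum (\<lambda>j. P (Inr (j, i))) (\<lambda>j. N (Inr (j, i)))"
  show "?u \<in> sympl_space \<alpha>" "\<And>i. ?x i \<in> sympl_space k"
    using assms by (auto simp: sympl_space_iff coord_space_def)
  show "?x i = (\<lambda>_. 0)" if "i \<ge> m" for i
    using assms that by (auto simp: coord_space_def split: sum.split)
  show "col_plus ?u ?x = P" "col_minus ?u ?x = N"
    unfolding col_plus_def col_minus_def by (auto split: sum.split)
qed

lemma tensor_ZpD:
  assumes "x \<in> tensor_Zp m Q" "Q \<subseteq> sympl_space k"
  shows "x i \<in> sympl_space k"
  using assms unfolding tensor_Zp_def by (cases "i < m") (auto simp: sympl_space_iff)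

lemma col_coord_space:
  assumes "u \<in> sympl_space \<alpha>" "x \<in> tensor_Zp m Q" "Q \<subseteq> sympl_space k"
  shows "col_plus u x \<in> coord_space (idx_set_fin \<alpha> k m)"
    "col_minus u x \<in> coord_space (idx_set_fin \<alpha> k m)"
proof -
  have "\<forall>i\<ge>m. x i = (\<lambda>_. 0)" using assms(2) unfolding tensor_Zp_def by blast
  moreover have "\<forall>i. \<forall>j\<ge>k. x i (Inl j) = 0 \<and> x i (Inr j) = 0"
    using tensor_ZpD[OF assms(2,3)] by (simp add: sympl_space_iff)
  moreover have "\<forall>i\<ge>\<alpha>. u (Inl i) = 0 \<and> u (Inr i) = 0"
    using assms(1) by (simp add: sympl_space_iff)
  ultimately have "col_plus u x b = 0 \<and> col_minus u x b = 0" if "b \<notin> idx_set_fin \<alpha> k m" for b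
    using that by (cases b rule: idx_cases) (auto simp: not_less)
  then show "col_plus u x \<in> coord_space (idx_set_fin \<alpha> k m)"
    "col_minus u x \<in> coord_space (idx_set_fin \<alpha> k m)"
    unfolding coord_space_def by blast+
qed

lemma coord_space_mono: "J \<subseteq> J' \<Longrightarrow> coord_space J \<subseteq> coord_space J'"
  unfolding coord_space_def by blast

lemma bG_fin_iff:
  "g \<in> bG_fin \<alpha> k m \<longleftrightarrow> g \<in> carrier (bG \<alpha> k) \<and> identity_off (idx_set \<alpha> k) (idx_set_fin \<alpha> k m) g"
  unfolding bG_fin_def identity_off_def by blast

lemma bG_finitary: "g \<in> carrier (bG \<alpha> k) \<Longrightarrow> finitary (idx_set \<alpha> k) g"
  unfolding bG_def carrier_GL_fin_iff by blast

section \<open>The defect of a tuple and its pairing with solutions\<close>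

text \<open>
  The defect vanishes exactly on the tuples of the definition of \<open>chi_rep\<close>; the minus equation is
  solved for the source column, so that the inverse of \<open>g\<^sup>t\<close> does not occur.
\<close>

definition defect where
  "defect g u x v y = case_sum
     (\<lambda>a. col_plus v y a - mat_vec g (col_plus u x) a)
     (\<lambda>a. col_minus u x a - mat_vec (mat_transp g) (col_minus v y) a)"

lemma defect_eq_0_iff:
  "defect g u x v y = (\<lambda>_. 0) \<longleftrightarrow>
    col_plus v y = mat_vec g (col_plus u x) \<and> col_minus u x = mat_vec (mat_transp g) (col_minus v y)"
  unfolding defect_def fun_eq_iff by (auto split: sum.split)

lemma chi_rep_eq:
  assumes "g \<in> carrier (bG \<alpha> k)" "Q \<subseteq> sympl_space k" "T \<subseteq> sympl_space k"
  shows "chi_rep \<alpha> k m g Q T = {case_sum u v | u v. u \<in> sympl_space \<alpha> \<and> v \<in> sympl_space \<alpha> \<and>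
     (\<exists>x\<in>tensor_Zp m Q. \<exists>y\<in>tensor_Zp m T. defect g u x v y = (\<lambda>_. 0))}"
proof -
  have "col_minus v y = mat_vec (inv\<^bsub>bG \<alpha> k\<^esub> (mat_transp g)) (col_minus u x) \<longleftrightarrow>
      col_minus u x = mat_vec (mat_transp g) (col_minus v y)"
    if "u \<in> sympl_space \<alpha>" "v \<in> sympl_space \<alpha>" "x \<in> tensor_Zp m Q" "y \<in> tensor_Zp m T" for u v x y
    using assms(1) unfolding bG_def
    by (intro mat_vec_inv_iff transp_in_GL_fin)
      (use that assms(2,3) col_coord_space coord_space_mono[OF idx_set_fin_subset] in blast)+
  then show ?thesis unfolding chi_rep_def defect_eq_0_iff by blast
qed

lemma col_add:
  "col_plus (\<lambda>i. u i + u' i) (\<lambda>i l. x i l + x' i l) = (\<lambda>a. col_plus u x a + col_plus u' x' a)"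
  "col_minus (\<lambda>i. u i + u' i) (\<lambda>i l. x i l + x' i l) = (\<lambda>a. col_minus u x a + col_minus u' x' a)"
  unfolding col_plus_def col_minus_def by (auto split: sum.split)

lemma col_scale:
  "col_plus (\<lambda>i. c * u i) (\<lambda>i l. c * x i l) = (\<lambda>a. c * col_plus u x a)"
  "col_minus (\<lambda>i. c * u i) (\<lambda>i l. c * x i l) = (\<lambda>a. c * col_minus u x a)"
  unfolding col_plus_def col_minus_def by (auto split: sum.split)

lemma defect_add:
  assumes "finitary I g"
  shows "defect g (\<lambda>i. u i + u' i) (\<lambda>i l. x i l + x' i l) (\<lambda>i. v i + v' i) (\<lambda>i l. y i l + y' i l)
    = (\<lambda>a. defect g u x v y a + defect g u' x' v' y' a)"
  unfolding defect_def col_add mat_vec_add[OF assms] mat_vec_add[OF finitary_transp[OF assms]]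
  by (auto split: sum.split)

lemma defect_scale:
  assumes "finitary I g"
  shows "defect g (\<lambda>i. c * u i) (\<lambda>i l. c * x i l) (\<lambda>i. c * v i) (\<lambda>i l. c * y i l)
    = (\<lambda>a. c * defect g u x v y a)"
  unfolding defect_def col_scale mat_vec_scale[OF assms] mat_vec_scale[OF finitary_transp[OF assms]]
  by (auto split: sum.split simp: algebra_simps)

lemma tensor_Zp_add:
  assumes "zp_submodule V Q" "x \<in> tensor_Zp m Q" "x' \<in> tensor_Zp m Q"
  shows "(\<lambda>i l. x i l + x' i l) \<in> tensor_Zp m Q"
  using assms(2,3) zp_submoduleD(3)[OF assms(1)] unfolding tensor_Zp_def by simp

lemma tensor_Zp_scale:
  assumes "zp_submodule V Q" "c \<in> Zp" "x \<in> tensor_Zp m Q"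
  shows "(\<lambda>i l. c * x i l) \<in> tensor_Zp m Q"
  using assms(2,3) zp_submoduleD(4)[OF assms(1)] unfolding tensor_Zp_def by simp

lemma tensor_Zp_0: "zp_submodule V Q \<Longrightarrow> (\<lambda>_ _. 0) \<in> tensor_Zp m Q"
  by (simp add: tensor_Zp_def zp_submoduleD(2))

text \<open>Off the block \<open>g\<close> is the identity and all columns vanish. Hence the defects
  lie in a finite-dimensional space, where separation applies.\<close>

lemma defect_coord_space:
  assumes "identity_off (idx_set \<alpha> k) (idx_set_fin \<alpha> k m) g"
    and "u \<in> sympl_space \<alpha>" "v \<in> sympl_space \<alpha>" "x \<in> tensor_Zp m Q" "y \<in> tensor_Zp m T"
    and "Q \<subseteq> sympl_space k" "T \<subseteq> sympl_space k"
  shows "defect g u x v y \<in> coord_space (idx_set_fin \<alpha> k m <+> idx_set_fin \<alpha> k m)"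
proof -
  let ?J = "idx_set_fin \<alpha> k m"
  note mv = mat_vec_identity_off[OF finite_idx_set_fin idx_set_fin_subset]
  have "col_plus u x a = 0" "col_minus u x a = 0" "col_plus v y a = 0" "col_minus v y a = 0"
    if "a \<notin> ?J" for a
    using col_coord_space[OF assms(2,4,6)] col_coord_space[OF assms(3,5,7)] that
    unfolding coord_space_def by blast+
  then have "defect g u x v y (Inl a) = 0" "defect g u x v y (Inr a) = 0" if "a \<notin> ?J" for a
    using that unfolding defect_def
    by (simp_all add: mv[OF assms(1)] mv[OF identity_off_transp[OF assms(1)]])
  then have "defect g u x v y b = 0" if "b \<notin> ?J <+> ?J" for b
    using that by (cases b) auto
  then show ?thesis unfolding coord_space_def by blast
qed

lemma sum_mat_vec_transp:
  assumes "finite J" "J \<subseteq> I" "identity_off I J g"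
  shows "(\<Sum>a\<in>J. z a * mat_vec g w a) = (\<Sum>a\<in>J. mat_vec (mat_transp g) z a * w a)"
proof -
  have "(\<Sum>a\<in>J. z a * mat_vec g w a) = (\<Sum>a\<in>J. \<Sum>b\<in>J. z a * g a b * w b)"
    by (simp add: mat_vec_identity_off[OF assms] sum_distrib_left mult.assoc)
  also have "\<dots> = (\<Sum>b\<in>J. \<Sum>a\<in>J. z a * g a b * w b)" by (rule sum.swap)
  also have "\<dots> = (\<Sum>b\<in>J. mat_vec (mat_transp g) z b * w b)"
    by (simp add: mat_vec_identity_off[OF assms(1,2) identity_off_transp[OF assms(3)]]
        sum_distrib_right mat_transp_def mult.commute[of "g _ _"])
  finally show ?thesis .
qed

text \<open>Adjointness moves \<open>g\<close> onto the primed columns, and the relation they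
  satisfy collects the four terms into two forms. For two solutions this yields isotropy; for one
  solution it evaluates the corresponding functional on arbitrary defects.\<close>

lemma defect_pairing:
  assumes g: "identity_off (idx_set \<alpha> k) (idx_set_fin \<alpha> k m) g"
    and 0: "defect g u' x' v' y' = (\<lambda>_. 0)"
  shows "(\<Sum>a\<in>idx_set_fin \<alpha> k m <+> idx_set_fin \<alpha> k m.
      case_sum (col_minus v' y') (col_plus u' x') a * defect g u x v y a)
    = (sympl_form \<alpha> u' u + (\<Sum>i<m. sympl_form k (x' i) (x i)))
      - (sympl_form \<alpha> v' v + (\<Sum>i<m. sympl_form k (y' i) (y i)))"
proof -
  let ?J = "idx_set_fin \<alpha> k m"
  note gt = identity_off_transp[OF g]
  have eqs: "mat_vec g (col_plus u' x') = col_plus v' y'"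
    "mat_vec (mat_transp g) (col_minus v' y') = col_minus u' x'"
    using 0 unfolding defect_eq_0_iff by simp_all
  have 1: "(\<Sum>a\<in>?J. col_minus v' y' a * mat_vec g (col_plus u x) a)
      = (\<Sum>a\<in>?J. col_minus u' x' a * col_plus u x a)"
    by (subst sum_mat_vec_transp[OF _ idx_set_fin_subset g]) (simp_all add: eqs)
  have 2: "(\<Sum>a\<in>?J. col_plus u' x' a * mat_vec (mat_transp g) (col_minus v y) a)
      = (\<Sum>a\<in>?J. col_plus v' y' a * col_minus v y a)"
    by (subst sum_mat_vec_transp[OF _ idx_set_fin_subset gt]) (simp_all add: eqs)
  show ?thesis
    unfolding col_sympl_form[symmetric] defect_def
    by (subst sum.Plus) (simp_all add: right_diff_distrib sum_subtractf 1 2)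
qed

lemma sympl_form_ominus_case_sum [simp]:
  "sympl_form_ominus n (case_sum u v) (case_sum u' v') = sympl_form n u u' - sympl_form n v v'"
  unfolding sympl_form_ominus_def by (simp add: o_def)

section \<open>Self-duality\<close>

lemma chi_rep_submodule:
  assumes g: "g \<in> carrier (bG \<alpha> k)"
    and Q: "zp_submodule (sympl_space k) Q" and T: "zp_submodule (sympl_space k) T"
  shows "zp_submodule (sympl_space2 \<alpha>) (chi_rep \<alpha> k m g Q T)"
proof -
  note eq = chi_rep_eq[OF g zp_submoduleD(1)[OF Q] zp_submoduleD(1)[OF T]]
  note fin = bG_finitary[OF g]
  have mem: "case_sum u v \<in> chi_rep \<alpha> k m g Q T"
    if "u \<in> sympl_space \<alpha>" "v \<in> sympl_space \<alpha>" "x \<in> tensor_Zp m Q" "y \<in> tensor_Zp m T"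
      "defect g u x v y = (\<lambda>_. 0)" for u v x y
    unfolding eq using that by blast
  show ?thesis
    unfolding zp_submodule_def[of "sympl_space2 \<alpha>"]
  proof (intro conjI ballI)
    show "chi_rep \<alpha> k m g Q T \<subseteq> sympl_space2 \<alpha>" unfolding eq sympl_space2_def by blast
  next
    have "defect g (\<lambda>_. 0) (\<lambda>_ _. 0) (\<lambda>_. 0) (\<lambda>_ _. 0) = (\<lambda>_. 0)"
      using defect_scale[OF fin, of 0] by simp
    then have "case_sum (\<lambda>_. 0) (\<lambda>_. 0) \<in> chi_rep \<alpha> k m g Q T"
      by (intro mem[OF _ _ tensor_Zp_0[OF Q] tensor_Zp_0[OF T]]) (simp_all add: sympl_space_iff)
    moreover have "case_sum (\<lambda>_. 0) (\<lambda>_. 0) = (\<lambda>_ :: (nat + nat) + (nat + nat). 0 :: 'a qp)"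
      by (auto split: sum.split)
    ultimately show "(\<lambda>_. 0) \<in> chi_rep \<alpha> k m g Q T" by simp
  next
    fix w w' assume "w \<in> chi_rep \<alpha> k m g Q T" "w' \<in> chi_rep \<alpha> k m g Q T"
    then obtain u v x y u' v' x' y' where *:
      "w = case_sum u v" "u \<in> sympl_space \<alpha>" "v \<in> sympl_space \<alpha>"
      "x \<in> tensor_Zp m Q" "y \<in> tensor_Zp m T" "defect g u x v y = (\<lambda>_. 0)"
      "w' = case_sum u' v'" "u' \<in> sympl_space \<alpha>" "v' \<in> sympl_space \<alpha>"
      "x' \<in> tensor_Zp m Q" "y' \<in> tensor_Zp m T" "defect g u' x' v' y' = (\<lambda>_. 0)"
      unfolding eq by blast
    have "case_sum (\<lambda>i. u i + u' i) (\<lambda>i. v i + v' i) \<in> chi_rep \<alpha> k m g Q T"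
      by (rule mem[OF _ _ tensor_Zp_add[OF Q *(4,10)] tensor_Zp_add[OF T *(5,11)]])
        (use * in \<open>simp_all add: sympl_space_iff defect_add[OF fin]\<close>)
    moreover have "case_sum (\<lambda>i. u i + u' i) (\<lambda>i. v i + v' i) = (\<lambda>i. w i + w' i)"
      unfolding * by (auto split: sum.split)
    ultimately show "(\<lambda>i. w i + w' i) \<in> chi_rep \<alpha> k m g Q T" by simp
  next
    fix c w assume c: "c \<in> (Zp :: 'a qp set)" and "w \<in> chi_rep \<alpha> k m g Q T"
    then obtain u v x y where *:
      "w = case_sum u v" "u \<in> sympl_space \<alpha>" "v \<in> sympl_space \<alpha>"
      "x \<in> tensor_Zp m Q" "y \<in> tensor_Zp m T" "defect g u x v y = (\<lambda>_. 0)"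
      unfolding eq by blast
    have "case_sum (\<lambda>i. c * u i) (\<lambda>i. c * v i) \<in> chi_rep \<alpha> k m g Q T"
      by (rule mem[OF _ _ tensor_Zp_scale[OF Q c *(4)] tensor_Zp_scale[OF T c *(5)]])
        (use * in \<open>simp_all add: sympl_space_iff defect_scale[OF fin]\<close>)
    moreover have "case_sum (\<lambda>i. c * u i) (\<lambda>i. c * v i) = (\<lambda>i. c * w i)"
      unfolding * by (auto split: sum.split)
    ultimately show "(\<lambda>i. c * w i) \<in> chi_rep \<alpha> k m g Q T" by simp
  qed
qed

text \<open>Test elements for the self-duality criterion, concentrated in a single
  coordinate.\<close>

lemma tensor_single:
  "(\<lambda>_. 0) \<in> Q \<Longrightarrow> q \<in> Q \<Longrightarrow> i < m \<Longrightarrow> (\<lambda>i'. if i' = i then q else (\<lambda>_. 0)) \<in> tensor_Zp m Q"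
  unfolding tensor_Zp_def by auto

lemma chi_rep_memI:
  assumes g: "g \<in> bG_fin \<alpha> k m"
    and Q: "self_dual (sympl_space k) (sympl_form k) Q"
    and T: "self_dual (sympl_space k) (sympl_form k) T"
    and u0: "u0 \<in> sympl_space \<alpha>" and v0: "v0 \<in> sympl_space \<alpha>"
    and orth: "\<And>w. w \<in> chi_rep \<alpha> k m g Q T \<Longrightarrow> sympl_form_ominus \<alpha> w (case_sum u0 v0) \<in> Zp"
  shows "case_sum u0 v0 \<in> chi_rep \<alpha> k m g Q T"
proof (rule ccontr)
  assume notin: "case_sum u0 v0 \<notin> chi_rep \<alpha> k m g Q T"
  let ?J = "idx_set_fin \<alpha> k m" and ?z = "\<lambda>_ :: nat + nat. 0 :: 'a qp"
    and ?zz = "\<lambda>(_ :: nat) (_ :: nat + nat). 0 :: 'a qp"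
  from g have gG: "g \<in> carrier (bG \<alpha> k)" and off: "identity_off (idx_set \<alpha> k) ?J g"
    unfolding bG_fin_iff by auto
  note fin = bG_finitary[OF gG]
  note Q' = self_dualD[OF Q] and T' = self_dualD[OF T]
  note eq = chi_rep_eq[OF gG Q'(2) T'(2)]
  note Q0 = tensor_Zp_0[OF Q'(1), of m] and T0 = tensor_Zp_0[OF T'(1), of m]
  have z0: "?z \<in> sympl_space n" for n by (simp add: sympl_space_iff)
  define S where "S = {defect g ?z x ?z y | x y. x \<in> tensor_Zp m Q \<and> y \<in> tensor_Zp m T}"
  have mem_S: "defect g ?z x ?z y \<in> S" if "x \<in> tensor_Zp m Q" "y \<in> tensor_Zp m T" for x y
    unfolding S_def using that by blast
  have add: "(\<lambda>a. defect g u x v y a + defect g ?z x' ?z y' a)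
      = defect g u (\<lambda>i l. x i l + x' i l) v (\<lambda>i l. y i l + y' i l)" for u x v y x' y'
    using defect_add[OF fin, of u ?z x x' v ?z y y'] by simp
  have scale: "(\<lambda>a. c * defect g ?z x ?z y a)
      = defect g ?z (\<lambda>i l. c * x i l) ?z (\<lambda>i l. c * y i l)" for c x y
    using defect_scale[OF fin, of c ?z x ?z y] by simp
  have "zp_submodule (coord_space (?J <+> ?J)) S"
    unfolding zp_submodule_def
  proof (intro conjI ballI)
    show "S \<subseteq> coord_space (?J <+> ?J)"
      unfolding S_def using defect_coord_space[OF off z0 z0 _ _ Q'(2) T'(2)] by blast
    have "defect g ?z ?zz ?z ?zz = (\<lambda>_. 0)" using scale[of 0 ?zz ?zz] by simp
    then show "(\<lambda>_. 0) \<in> S" using mem_S[OF Q0 T0] by simp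
  next
    fix s s' assume "s \<in> S" "s' \<in> S"
    then obtain x y x' y' where *: "s = defect g ?z x ?z y" "x \<in> tensor_Zp m Q" "y \<in> tensor_Zp m T"
      "s' = defect g ?z x' ?z y'" "x' \<in> tensor_Zp m Q" "y' \<in> tensor_Zp m T"
      unfolding S_def by blast
    show "(\<lambda>a. s a + s' a) \<in> S"
      unfolding * add by (intro mem_S tensor_Zp_add[OF Q'(1)] tensor_Zp_add[OF T'(1)] *)
  next
    fix c s assume c: "c \<in> (Zp :: 'a qp set)" and "s \<in> S"
    then obtain x y where *: "s = defect g ?z x ?z y" "x \<in> tensor_Zp m Q" "y \<in> tensor_Zp m T"
      unfolding S_def by blast
    show "(\<lambda>a. c * s a) \<in> S"
      unfolding * scale by (intro mem_S tensor_Zp_scale[OF Q'(1) c] tensor_Zp_scale[OF T'(1) c] *)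
  qed
  \<comment> \<open>With this sign, membership in \<open>S\<close> means that some \<open>x\<close>
    and \<open>y\<close> cancel the defect of \<open>u0\<close> and \<open>v0\<close>.\<close>
  moreover have "(\<lambda>a. - defect g u0 ?zz v0 ?zz a) \<in> coord_space (?J <+> ?J)"
    using defect_coord_space[OF off u0 v0 Q0 T0 Q'(2) T'(2)] unfolding coord_space_def by simp
  moreover have "(\<lambda>a. - defect g u0 ?zz v0 ?zz a) \<notin> S"
  proof
    assume "(\<lambda>a. - defect g u0 ?zz v0 ?zz a) \<in> S"
    then obtain x y where x: "x \<in> tensor_Zp m Q" and y: "y \<in> tensor_Zp m T"
      and d: "(\<lambda>a. - defect g u0 ?zz v0 ?zz a) = defect g ?z x ?z y" unfolding S_def by blast
    have "defect g u0 x v0 y = (\<lambda>_. 0)"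
      using add[of u0 ?zz v0 ?zz x y] unfolding d[symmetric] by simp
    then have "case_sum u0 v0 \<in> chi_rep \<alpha> k m g Q T"
      unfolding eq using u0 v0 x y by blast
    with notin show False ..
  qed
  ultimately obtain c where
    cS: "\<And>s. s \<in> S \<Longrightarrow> (\<Sum>a\<in>?J <+> ?J. c a * s a) \<in> Zp" and
    ce: "(\<Sum>a\<in>?J <+> ?J. c a * - defect g u0 ?zz v0 ?zz a) \<notin> Zp"
    using zp_submodule_separation[of "?J <+> ?J" S "\<lambda>a. - defect g u0 ?zz v0 ?zz a"]
    by (auto simp: finite_Plus)
  \<comment> \<open>Separation says nothing about \<open>c\<close> off the block; cutting it off
    there leaves the sums unchanged and gives columns in \<open>coord_space\<close>.\<close>
  define C where "C a = (if a \<in> ?J then c (Inl a) else 0)" for a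
  define D where "D a = (if a \<in> ?J then c (Inr a) else 0)" for a
  have CD: "C \<in> coord_space ?J" "D \<in> coord_space ?J"
    unfolding C_def D_def coord_space_def by auto
  note mv = mat_vec_identity_off[OF finite_idx_set_fin idx_set_fin_subset]
  have coord: "mat_vec h w \<in> coord_space ?J"
    if "identity_off (idx_set \<alpha> k) ?J h" "w \<in> coord_space ?J" for h and w :: "idx \<Rightarrow> 'a qp"
    using that(2) unfolding coord_space_def by (simp add: mv[OF that(1)])
  \<comment> \<open>To match \<open>defect_pairing\<close>, \<open>C\<close> becomes the minus
    column of the target and \<open>D\<close> the plus column of the source; the relation forces the
    other two columns.\<close>
  obtain u x where u: "u \<in> sympl_space \<alpha>" and x: "\<And>i. x i \<in> sympl_space k"
    "\<And>i. i \<ge> m \<Longrightarrow> x i = ?z"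
    and ux: "col_plus u x = D" "col_minus u x = mat_vec (mat_transp g) C"
    using col_surj[OF CD(2) coord[OF identity_off_transp[OF off] CD(1)]] by metis
  obtain v y where v: "v \<in> sympl_space \<alpha>" and y: "\<And>i. y i \<in> sympl_space k"
    "\<And>i. i \<ge> m \<Longrightarrow> y i = ?z"
    and vy: "col_plus v y = mat_vec g D" "col_minus v y = C"
    using col_surj[OF coord[OF off CD(2)] CD(1)] by metis
  have d0: "defect g u x v y = (\<lambda>_. 0)" unfolding defect_eq_0_iff ux vy by simp
  have "(\<Sum>a\<in>?J <+> ?J. c a * s a) = (\<Sum>a\<in>?J <+> ?J. case_sum C D a * s a)" for s
    by (rule sum.cong) (auto simp: C_def D_def)
  then have pair: "(\<Sum>a\<in>?J <+> ?J. c a * defect g u' x' v' y' a)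
    = (sympl_form \<alpha> u u' + (\<Sum>i<m. sympl_form k (x i) (x' i)))
      - (sympl_form \<alpha> v v' + (\<Sum>i<m. sympl_form k (y i) (y' i)))" for u' x' v' y'
    using defect_pairing[OF off d0, of u' x' v' y'] unfolding ux vy by simp
  have single: "(\<Sum>i'<m. sympl_form k (f i') ((\<lambda>i'. if i' = i then q else ?z) i')) = sympl_form k (f i) q"
    if "i < m" for f i q
  proof -
    have "(\<Sum>i'<m. sympl_form k (f i') (if i' = i then q else ?z))
        = (\<Sum>i'<m. if i' = i then sympl_form k (f i') q else 0)" by (rule sum.cong) auto
    then show ?thesis using that by simp
  qed
  \<comment> \<open>On a defect with \<open>q\<close> in the single coordinate \<open>i\<close> the
    functional is the pairing of \<open>x i\<close> with \<open>q\<close>. Its integrality on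
    \<open>S\<close> and the self-duality of \<open>Q\<close> place \<open>x i\<close> in
    \<open>Q\<close>.\<close>
  have "x i \<in> Q" if i: "i < m" for i
  proof (rule self_dual_memI[OF Q x(1)])
    fix q assume q: "q \<in> Q"
    have "sympl_form k (x i) q
        = (\<Sum>a\<in>?J <+> ?J. c a * defect g ?z (\<lambda>i'. if i' = i then q else ?z) ?z ?zz a)"
      unfolding pair single[OF i] by simp
    also have "\<dots> \<in> Zp" by (intro cS mem_S tensor_single Q'(3) q i T0)
    finally show "sympl_form k (x i) q \<in> Zp" .
  qed
  then have xQ: "x \<in> tensor_Zp m Q" using x(2) unfolding tensor_Zp_def by blast
  have "y i \<in> T" if i: "i < m" for i
  proof (rule self_dual_memI[OF T y(1)])
    fix q assume q: "q \<in> T"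
    have "- sympl_form k (y i) q
        = (\<Sum>a\<in>?J <+> ?J. c a * defect g ?z ?zz ?z (\<lambda>i'. if i' = i then q else ?z) a)"
      unfolding pair single[OF i] by simp
    also have "\<dots> \<in> Zp" by (intro cS mem_S tensor_single T'(3) q i Q0)
    finally show "sympl_form k (y i) q \<in> Zp" using Zp_uminus by fastforce
  qed
  then have yT: "y \<in> tensor_Zp m T" using y(2) unfolding tensor_Zp_def by blast
  \<comment> \<open>The constructed element is now admissible for \<open>orth\<close>, while its
    pairing with \<open>u0\<close> and \<open>v0\<close> is, up to sign, the non-integral value of
    the functional.\<close>
  have "case_sum u v \<in> chi_rep \<alpha> k m g Q T" unfolding eq using u v xQ yT d0 by blast
  then have "sympl_form \<alpha> u u0 - sympl_form \<alpha> v v0 \<in> Zp" using orth by fastforce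
  moreover have "(\<Sum>a\<in>?J <+> ?J. c a * - defect g u0 ?zz v0 ?zz a)
      = - (sympl_form \<alpha> u u0 - sympl_form \<alpha> v v0)"
    using pair[of u0 ?zz v0 ?zz] by (simp add: sum_negf)
  ultimately show False using ce Zp_uminus by metis
qed

lemma chi_rep_self_dual:
  assumes g: "g \<in> bG_fin \<alpha> k m"
    and Q: "self_dual (sympl_space k) (sympl_form k) Q"
    and T: "self_dual (sympl_space k) (sympl_form k) T"
  shows "chi_rep \<alpha> k m g Q T \<in> Naz_bar \<alpha>"
proof -
  let ?J = "idx_set_fin \<alpha> k m" and ?C = "chi_rep \<alpha> k m g Q T"
  from g have gG: "g \<in> carrier (bG \<alpha> k)" and off: "identity_off (idx_set \<alpha> k) ?J g"
    unfolding bG_fin_iff by auto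
  note Q' = self_dualD[OF Q] and T' = self_dualD[OF T]
  note eq = chi_rep_eq[OF gG Q'(2) T'(2)]
  have "sympl_form_ominus \<alpha> w w' \<in> Zp" if "w \<in> ?C" "w' \<in> ?C" for w w'
  proof -
    obtain u v x y u' v' x' y' where w: "w = case_sum u v" "w' = case_sum u' v'"
      and x: "x \<in> tensor_Zp m Q" "x' \<in> tensor_Zp m Q" and y: "y \<in> tensor_Zp m T" "y' \<in> tensor_Zp m T"
      and d: "defect g u x v y = (\<lambda>_. 0)" "defect g u' x' v' y' = (\<lambda>_. 0)"
      using \<open>w \<in> ?C\<close> \<open>w' \<in> ?C\<close> unfolding eq by blast
    \<comment> \<open>For two solutions the left side of \<open>defect_pairing\<close> is zero, so
      the outer form equals the contribution of \<open>y\<close> minus that of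
      \<open>x\<close>.\<close>
    have "sympl_form_ominus \<alpha> w w' =
        (\<Sum>i<m. sympl_form k (y i) (y' i)) - (\<Sum>i<m. sympl_form k (x i) (x' i))"
      using defect_pairing[OF off d(1), of u' x' v' y'] unfolding d(2) w by (simp add: algebra_simps)
    also have "\<dots> \<in> Zp"
      using x y unfolding tensor_Zp_def by (intro Zp_diff Zp_sum Q'(4) T'(4)) auto
    finally show ?thesis .
  qed
  then have "isotropic (sympl_space2 \<alpha>) (sympl_form_ominus \<alpha>) ?C"
    unfolding isotropic_def using chi_rep_submodule[OF gG Q'(1) T'(1)] by blast
  moreover have "R = ?C"
    if iso: "isotropic (sympl_space2 \<alpha>) (sympl_form_ominus \<alpha>) R" and sub: "?C \<subseteq> R" for R
  proof (rule antisym)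
    show "R \<subseteq> ?C"
    proof
      fix w assume w: "w \<in> R"
      then obtain u v where uv: "w = case_sum u v" "u \<in> sympl_space \<alpha>" "v \<in> sympl_space \<alpha>"
        using iso zp_submoduleD(1) unfolding isotropic_def sympl_space2_def by blast
      show "w \<in> ?C" unfolding uv(1)
        by (rule chi_rep_memI[OF g Q T uv(2,3)])
          (use iso sub w uv(1) in \<open>auto simp: isotropic_def\<close>)
    qed
  qed (fact sub)
  ultimately show ?thesis unfolding Naz_bar_def self_dual_def by blast
qed

section \<open>Independence of the representative\<close>

text \<open>Coordinates from \<open>m\<close> on do not enter the equations of the block. Setting
  them to zero keeps a solution, and conversely a solution of level \<open>m\<close> is one of level
  \<open>m'\<close> because zero lies in \<open>Q\<close> and \<open>T\<close>.\<close>

lemma chi_rep_mono_m: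
  assumes g: "g \<in> bG_fin \<alpha> k m" and m: "m \<le> m'"
    and Q: "zp_submodule (sympl_space k) Q" and T: "zp_submodule (sympl_space k) T"
  shows "chi_rep \<alpha> k m g Q T = chi_rep \<alpha> k m' g Q T"
proof -
  let ?J = "idx_set_fin \<alpha> k m"
  from g have gG: "g \<in> carrier (bG \<alpha> k)" and off: "identity_off (idx_set \<alpha> k) ?J g"
    unfolding bG_fin_iff by auto
  note Q' = zp_submoduleD[OF Q] and T' = zp_submoduleD[OF T]
  note eq = chi_rep_eq[OF gG Q'(1) T'(1)]
  note mv = mat_vec_identity_off[OF finite_idx_set_fin idx_set_fin_subset]
  have incl: "x \<in> tensor_Zp m' R" if "x \<in> tensor_Zp m R" "(\<lambda>_. 0) \<in> R" for R and x :: "nat \<Rightarrow> nat + nat \<Rightarrow> 'a qp"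
    unfolding tensor_Zp_def
  proof (intro CollectI conjI allI impI)
    show "x i \<in> R" if "i < m'" for i
      using \<open>x \<in> tensor_Zp m R\<close> \<open>(\<lambda>_. 0) \<in> R\<close> unfolding tensor_Zp_def by (cases "i < m") simp_all
    show "x i = (\<lambda>_. 0)" if "m' \<le> i" for i
      using \<open>x \<in> tensor_Zp m R\<close> that m unfolding tensor_Zp_def by simp
  qed
  define tr where "tr x i = (if i < m then x i else (\<lambda>_. 0))" for x :: "nat \<Rightarrow> nat + nat \<Rightarrow> 'a qp" and i
  have tr: "tr x \<in> tensor_Zp m R" if "x \<in> tensor_Zp m' R" for x R
    using that m unfolding tr_def tensor_Zp_def by auto
  have "defect g u (tr x) v (tr y) = (\<lambda>_. 0)"
    if u: "u \<in> sympl_space \<alpha>" and v: "v \<in> sympl_space \<alpha>"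
      and x: "x \<in> tensor_Zp m' Q" and y: "y \<in> tensor_Zp m' T" and d: "defect g u x v y = (\<lambda>_. 0)"
    for u v x y
  proof -
    have tr_col: "col_plus w (tr z) a = col_plus w z a" "col_minus w (tr z) a = col_minus w z a"
      if "a \<in> ?J" for w z a
      using that by (cases a rule: idx_cases; simp add: tr_def)+
    have "defect g u (tr x) v (tr y) (Inl a) = defect g u x v y (Inl a)"
      "defect g u (tr x) v (tr y) (Inr a) = defect g u x v y (Inr a)" if "a \<in> ?J" for a
      using that unfolding defect_def
      by (simp_all add: mv[OF off] mv[OF identity_off_transp[OF off]] tr_col)
    then have "defect g u (tr x) v (tr y) b = 0" if "b \<in> ?J <+> ?J" for b
      using that d by auto
    moreover have "defect g u (tr x) v (tr y) b = 0" if "b \<notin> ?J <+> ?J" for b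
      using defect_coord_space[OF off u v tr[OF x] tr[OF y] Q'(1) T'(1)] that
      unfolding coord_space_def by blast
    ultimately show ?thesis by blast
  qed
  then show ?thesis
    unfolding eq using tr incl Q'(2) T'(2) by blast
qed

section \<open>Action of the orthogonal group on columns and invariance under two-sided
  multiplication\<close>

lemma frakI_simps [simp]:
  "frakI \<alpha> k u (Inl a) (Inl a') = (if a = a' \<and> a < \<alpha> then 1 else 0)"
  "frakI \<alpha> k u (Inl a) (Inr b) = 0" "frakI \<alpha> k u (Inr b) (Inl a) = 0"
  "frakI \<alpha> k u (Inr (j, i)) (Inr (j', i')) = (if j = j' \<and> j < k then u i i' else 0)"
  unfolding frakI_def by (auto split: prod.split)

lemma mat_vec_frakI:
  assumes "finitary UNIV u"
  shows "mat_vec (frakI \<alpha> k u) w = case_sum (\<lambda>a. if a < \<alpha> then w (Inl a) else 0)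
    (\<lambda>(j, i). if j < k then mat_vec u (\<lambda>i'. w (Inr (j, i'))) i else 0)"
proof
  fix b :: idx
  show "mat_vec (frakI \<alpha> k u) w b = case_sum (\<lambda>a. if a < \<alpha> then w (Inl a) else 0)
    (\<lambda>(j, i). if j < k then mat_vec u (\<lambda>i'. w (Inr (j, i'))) i else 0) b"
  proof (cases b rule: idx_cases)
    case (1 a)
    have "mat_vec (frakI \<alpha> k u) w (Inl a) = (\<Sum>b\<in>{Inl a}. frakI \<alpha> k u (Inl a) b * w b)"
      unfolding mat_vec_def
    proof (rule Sum_any.expand_superset)
      show "{b. frakI \<alpha> k u (Inl a) b * w b \<noteq> 0} \<subseteq> {Inl a}"
      proof
        fix b assume "b \<in> {b. frakI \<alpha> k u (Inl a) b * w b \<noteq> 0}"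
        then show "b \<in> {Inl a}" by (cases b rule: idx_cases) (auto split: if_splits)
      qed
    qed simp
    then show ?thesis using 1 by simp
  next
    case (2 j i)
    have fin: "finite {i'. u i i' \<noteq> 0}"
    proof -
      obtain J where J: "finite J" "identity_off UNIV J u" using assms unfolding finitary_iff by blast
      \<comment> \<open>A row outside \<open>J\<close> still has its diagonal entry, hence the
        inserted \<open>i\<close>.\<close>
      have "{i'. u i i' \<noteq> 0} \<subseteq> insert i J"
        using identity_offD[OF J(2)] by (auto simp: one_mat_def split: if_splits)
      then show ?thesis using J(1) finite_subset by blast
    qed
    have "mat_vec (frakI \<alpha> k u) w (Inr (j, i))
        = (\<Sum>b\<in>(\<lambda>i'. Inr (j, i')) ` {i'. u i i' \<noteq> 0}. frakI \<alpha> k u (Inr (j, i)) b * w b)"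
      unfolding mat_vec_def
    proof (rule Sum_any.expand_superset)
      show "{b. frakI \<alpha> k u (Inr (j, i)) b * w b \<noteq> 0} \<subseteq> (\<lambda>i'. Inr (j, i')) ` {i'. u i i' \<noteq> 0}"
      proof
        fix b assume "b \<in> {b. frakI \<alpha> k u (Inr (j, i)) b * w b \<noteq> 0}"
        then show "b \<in> (\<lambda>i'. Inr (j, i')) ` {i'. u i i' \<noteq> 0}"
          by (cases b rule: idx_cases) (auto split: if_splits)
      qed
    qed (simp add: fin)
    also have "\<dots> = (\<Sum>i'\<in>{i'. u i i' \<noteq> 0}. frakI \<alpha> k u (Inr (j, i)) (Inr (j, i')) * w (Inr (j, i')))"
      by (subst sum.reindex) (auto simp: inj_on_def)
    also have "\<dots> = (if j < k then \<Sum>i'\<in>{i'. u i i' \<noteq> 0}. u i i' * w (Inr (j, i')) else 0)"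
      by simp
    also have "(\<Sum>i'\<in>{i'. u i i' \<noteq> 0}. u i i' * w (Inr (j, i'))) = mat_vec u (\<lambda>i'. w (Inr (j, i'))) i"
      unfolding mat_vec_def using fin by (intro Sum_any.expand_superset[symmetric]) auto
    finally show ?thesis using 2 by simp
  qed
qed

lemma frakI_mat_mul:
  assumes "finitary UNIV u"
  shows "mat_mul (frakI \<alpha> k u) (frakI \<alpha> k u') = frakI \<alpha> k (mat_mul u u')"
proof (intro ext)
  fix a c :: idx
  show "mat_mul (frakI \<alpha> k u) (frakI \<alpha> k u') a c = frakI \<alpha> k (mat_mul u u') a c"
    unfolding mat_mul_eq_mat_vec[of "frakI \<alpha> k u"] mat_vec_frakI[OF assms]
    by (cases a rule: idx_cases; cases c rule: idx_cases) (simp_all add: mat_mul_eq_mat_vec)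
qed

lemma frakI_transp: "mat_transp (frakI \<alpha> k u) = frakI \<alpha> k (mat_transp u)"
proof (intro ext)
  fix a c :: idx
  show "mat_transp (frakI \<alpha> k u) a c = frakI \<alpha> k (mat_transp u) a c"
    by (cases a rule: idx_cases; cases c rule: idx_cases) (auto simp: mat_transp_def)
qed

lemma frakI_one_mat: "frakI \<alpha> k (one_mat UNIV) = one_mat (idx_set \<alpha> k)"
proof (intro ext)
  fix a c :: idx
  show "frakI \<alpha> k (one_mat UNIV) a c = one_mat (idx_set \<alpha> k) a c"
    by (cases a rule: idx_cases; cases c rule: idx_cases) (auto simp: one_mat_def)
qed

lemma frakI_identity_off:
  assumes "identity_off UNIV {..<m} u"
  shows "identity_off (idx_set \<alpha> k) (idx_set_fin \<alpha> k m) (frakI \<alpha> k u)"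
  unfolding identity_off_def
proof (intro allI impI)
  fix a c :: idx
  assume "(a, c) \<notin> idx_set_fin \<alpha> k m \<times> idx_set_fin \<alpha> k m"
  then show "frakI \<alpha> k u a c = one_mat (idx_set \<alpha> k) a c"
    using identity_offD[OF assms]
    by (cases a rule: idx_cases; cases c rule: idx_cases) (auto simp: one_mat_def)
qed

lemma frakI_finitary:
  assumes "identity_off UNIV {..<m} u"
  shows "finitary (idx_set \<alpha> k) (frakI \<alpha> k u)"
  unfolding finitary_iff
  by (intro exI[of _ "idx_set_fin \<alpha> k m"] conjI finite_idx_set_fin idx_set_fin_subset
      frakI_identity_off assms)

lemma O_inf_ZpD:
  assumes "u \<in> O_inf_Zp"
  shows "finitary UNIV u" "u a b \<in> Zp" "mat_transp u \<in> O_inf_Zp"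
    "mat_mul u (mat_transp u) = one_mat UNIV" "mat_mul (mat_transp u) u = one_mat UNIV"
  using assms finitary_transp unfolding O_inf_Zp_def by (auto simp: mat_transp_def[of u])

lemma one_mat_O_inf_Zp: "one_mat UNIV \<in> O_inf_Zp"
  unfolding O_inf_Zp_def
  by (simp add: finitary_one_mat mat_transp_one_mat mat_mul_one_left one_mat_def[of UNIV "_ :: nat"])

text \<open>The action of \<open>u\<close> on the second factor of the tensor product of
  \<open>\<H>\<close> with the coordinate space.\<close>

definition act :: "(nat, 'p :: prime_card) qmat \<Rightarrow> (nat \<Rightarrow> nat + nat \<Rightarrow> 'p qp) \<Rightarrow> nat \<Rightarrow> nat + nat \<Rightarrow> 'p qp"
  where "act u x i l = mat_vec u (\<lambda>i'. x i' l) i"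

text \<open>The entries of \<open>u\<close> are integral, so each new coordinate vector is a
  \<open>Zp\<close>-combination of elements of \<open>Q\<close>.\<close>

lemma act_tensor_Zp:
  assumes u: "u \<in> O_inf_Zp" "identity_off UNIV {..<m} u"
    and Q: "zp_submodule V Q" and x: "x \<in> tensor_Zp m Q"
  shows "act u x \<in> tensor_Zp m Q"
  unfolding tensor_Zp_def
proof (intro CollectI conjI allI impI)
  note mv = mat_vec_identity_off[OF _ _ u(2)]
  show "act u x i \<in> Q" if "i < m" for i
  proof -
    have "act u x i = (\<lambda>l. \<Sum>i'\<in>{..<m}. u i i' * x i' l)"
      using that unfolding act_def by (simp add: mv)
    also have "\<dots> \<in> Q"
      using x O_inf_ZpD(2)[OF u(1)] unfolding tensor_Zp_def by (intro zp_submodule_sum[OF Q]) auto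
    finally show ?thesis .
  qed
  show "act u x i = (\<lambda>_. 0)" if "m \<le> i" for i
    using that x unfolding act_def tensor_Zp_def by (simp add: mv)
qed

lemma mat_vec_frakI_col:
  assumes "finitary UNIV u" "w \<in> sympl_space \<alpha>" "x \<in> tensor_Zp m Q" "Q \<subseteq> sympl_space k"
  shows "mat_vec (frakI \<alpha> k u) (col_plus w x) = col_plus w (act u x)"
    "mat_vec (frakI \<alpha> k u) (col_minus w x) = col_minus w (act u x)"
proof -
  have x: "x i (Inl j) = 0" "x i (Inr j) = 0" if "\<not> j < k" for i j
    using tensor_ZpD[OF assms(3,4), of i] that by (auto simp: sympl_space_iff)
  have w: "w (Inl a) = 0" "w (Inr a) = 0" if "\<not> a < \<alpha>" for a
    using assms(2) that by (auto simp: sympl_space_iff)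
  have "mat_vec (frakI \<alpha> k u) (col_plus w x) b = col_plus w (act u x) b \<and>
    mat_vec (frakI \<alpha> k u) (col_minus w x) b = col_minus w (act u x) b" for b
    by (cases b rule: idx_cases) (simp_all add: mat_vec_frakI[OF assms(1)] act_def x w)
  then show "mat_vec (frakI \<alpha> k u) (col_plus w x) = col_plus w (act u x)"
    "mat_vec (frakI \<alpha> k u) (col_minus w x) = col_minus w (act u x)" by blast+
qed

text \<open>These matrices equal their own inverse transposes, so they transform plus and minus
  columns in the same way.\<close>

lemma frakI_orthogonal:
  assumes "u \<in> O_inf_Zp"
  shows "mat_mul (mat_transp (frakI \<alpha> k u)) (frakI \<alpha> k u) = one_mat (idx_set \<alpha> k)"
    "mat_mul (frakI \<alpha> k u) (mat_transp (frakI \<alpha> k u)) = one_mat (idx_set \<alpha> k)"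
  by (simp_all add: frakI_transp frakI_mat_mul frakI_one_mat O_inf_ZpD[OF assms] finitary_transp)

text \<open>Witnesses \<open>x\<close>, \<open>y\<close> for the product become witnesses for
  \<open>g\<close> when \<open>u2\<close> is applied to \<open>x\<close> and the transpose of
  \<open>u1\<close> to \<open>y\<close>. The outer vectors \<open>u\<close> and \<open>v\<close>
  stay fixed, since \<open>frakI\<close> is the identity on the finite part.\<close>

lemma chi_rep_mult_subset:
  assumes g: "g \<in> carrier (bG \<alpha> k)"
    and g': "mat_mul (mat_mul (frakI \<alpha> k u1) g) (frakI \<alpha> k u2) \<in> carrier (bG \<alpha> k)"
    and u1: "u1 \<in> O_inf_Zp" "identity_off UNIV {..<m} u1"
    and u2: "u2 \<in> O_inf_Zp" "identity_off UNIV {..<m} u2"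
    and Q: "zp_submodule (sympl_space k) Q" and T: "zp_submodule (sympl_space k) T"
  shows "chi_rep \<alpha> k m (mat_mul (mat_mul (frakI \<alpha> k u1) g) (frakI \<alpha> k u2)) Q T \<subseteq> chi_rep \<alpha> k m g Q T"
proof
  let ?I = "idx_set \<alpha> k" and ?K1 = "frakI \<alpha> k u1" and ?K2 = "frakI \<alpha> k u2"
  let ?g' = "mat_mul (mat_mul ?K1 g) ?K2"
  note Q' = zp_submoduleD(1)[OF Q] and T' = zp_submoduleD(1)[OF T]
  have K: "finitary ?I ?K1" "finitary ?I ?K2"
    using frakI_finitary[OF u1(2)] frakI_finitary[OF u2(2)] by auto
  note Kt = K[THEN finitary_transp]
  note fin = bG_finitary[OF g] finitary_transp[OF bG_finitary[OF g]]
  fix w assume "w \<in> chi_rep \<alpha> k m ?g' Q T"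
  then obtain u v x y where w: "w = case_sum u v" and u: "u \<in> sympl_space \<alpha>" and v: "v \<in> sympl_space \<alpha>"
    and x: "x \<in> tensor_Zp m Q" and y: "y \<in> tensor_Zp m T"
    and "defect ?g' u x v y = (\<lambda>_. 0)"
    unfolding chi_rep_eq[OF g' Q' T'] by blast
  then have "col_plus v y = mat_vec ?g' (col_plus u x)"
    "col_minus u x = mat_vec (mat_transp ?g') (col_minus v y)"
    unfolding defect_eq_0_iff by auto
  then have p: "col_plus v y = mat_vec ?K1 (mat_vec g (mat_vec ?K2 (col_plus u x)))"
    and n: "col_minus u x
      = mat_vec (mat_transp ?K2) (mat_vec (mat_transp g) (mat_vec (mat_transp ?K1) (col_minus v y)))"
    unfolding mat_transp_mat_mul
    by (simp_all add: mat_vec_mat_mul[where I = ?I] finitary_mat_mul K Kt fin)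
  \<comment> \<open>\<open>one_mat\<close> fixes only columns supported in the index set;
    \<open>supp\<close> provides this for columns produced by finitary matrices.\<close>
  have cancel: "mat_vec h (mat_vec h' z) = z'"
    if "mat_mul h h' = one_mat ?I" "finitary ?I h" "finitary ?I h'" "\<forall>a. a \<notin> ?I \<longrightarrow> z a = 0" "z' = z"
    for h h' and z z' :: "idx \<Rightarrow> 'a qp"
    using that unfolding mat_vec_mat_mul[OF that(2,3), symmetric] that(1)
    by (auto simp: mat_vec_one_mat)
  have supp: "\<forall>a. a \<notin> ?I \<longrightarrow> mat_vec h z a = 0" if "finitary ?I h" for h and z :: "idx \<Rightarrow> 'a qp"
    using that unfolding mat_vec_def finitary_def by auto
  let ?x = "act u2 x" and ?y = "act (mat_transp u1) y"
  have u1t: "mat_transp u1 \<in> O_inf_Zp" "identity_off UNIV {..<m} (mat_transp u1)"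
    using O_inf_ZpD(3)[OF u1(1)] identity_off_transp[OF u1(2)] by auto
  note cx = mat_vec_frakI_col[OF O_inf_ZpD(1)[OF u2(1)] u x Q']
  note cy = mat_vec_frakI_col[OF O_inf_ZpD(1)[OF u1t(1)] v y T', folded frakI_transp]
  have "col_plus v ?y = mat_vec g (col_plus u ?x)"
    unfolding cy(1)[symmetric] cx(1)[symmetric]
    by (subst p, rule cancel[OF frakI_orthogonal(1)[OF u1(1)] Kt(1) K(1) supp[OF fin(1)] refl])
  moreover have "col_minus u ?x = mat_vec (mat_transp g) (col_minus v ?y)"
    unfolding cy(2)[symmetric] cx(2)[symmetric]
    by (subst n, rule cancel[OF frakI_orthogonal(2)[OF u2(1)] K(2) Kt(2) supp[OF fin(2)] refl])
  ultimately have "defect g u ?x v ?y = (\<lambda>_. 0)" unfolding defect_eq_0_iff by blast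
  then show "w \<in> chi_rep \<alpha> k m g Q T"
    unfolding chi_rep_eq[OF g Q' T'] w
    using u v act_tensor_Zp[OF u2 Q x] act_tensor_Zp[OF u1t T y] by blast
qed

lemma chi_rep_mult:
  assumes g: "g \<in> carrier (bG \<alpha> k)"
    and g': "mat_mul (mat_mul (frakI \<alpha> k u1) g) (frakI \<alpha> k u2) \<in> carrier (bG \<alpha> k)"
    and u1: "u1 \<in> O_inf_Zp" "identity_off UNIV {..<m} u1"
    and u2: "u2 \<in> O_inf_Zp" "identity_off UNIV {..<m} u2"
    and Q: "zp_submodule (sympl_space k) Q" and T: "zp_submodule (sympl_space k) T"
  shows "chi_rep \<alpha> k m (mat_mul (mat_mul (frakI \<alpha> k u1) g) (frakI \<alpha> k u2)) Q T = chi_rep \<alpha> k m g Q T"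
proof (rule antisym)
  let ?I = "idx_set \<alpha> k" and ?K1 = "frakI \<alpha> k u1" and ?K2 = "frakI \<alpha> k u2"
  let ?g' = "mat_mul (mat_mul ?K1 g) ?K2"
  show "chi_rep \<alpha> k m ?g' Q T \<subseteq> chi_rep \<alpha> k m g Q T"
    by (rule chi_rep_mult_subset) fact+
  have K: "finitary ?I ?K1" "finitary ?I ?K2"
    using frakI_finitary[OF u1(2)] frakI_finitary[OF u2(2)] by auto
  note Kt = K[THEN finitary_transp] and fin = bG_finitary[OF g]
  have "mat_mul (mat_mul (mat_transp ?K1) ?g') (mat_transp ?K2)
      = mat_mul (mat_mul (mat_mul (mat_transp ?K1) ?K1) g) (mat_mul ?K2 (mat_transp ?K2))"
    by (simp add: mat_mul_assoc[where I = ?I] K Kt fin finitary_mat_mul)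
  also have "\<dots> = g"
    by (simp add: frakI_orthogonal u1 u2 mat_mul_one_left mat_mul_one_right fin)
  finally have eq: "mat_mul (mat_mul (frakI \<alpha> k (mat_transp u1)) ?g') (frakI \<alpha> k (mat_transp u2)) = g"
    by (simp add: frakI_transp)
  \<comment> \<open>The same inclusion for the transposes of \<open>u1\<close> and \<open>u2\<close>
    undoes the multiplication and gives the converse.\<close>
  have "chi_rep \<alpha> k m (mat_mul (mat_mul (frakI \<alpha> k (mat_transp u1)) ?g') (frakI \<alpha> k (mat_transp u2))) Q T
      \<subseteq> chi_rep \<alpha> k m ?g' Q T"
    by (rule chi_rep_mult_subset[OF g' _ _ _ _ _ Q T])
      (use g u1 u2 in \<open>simp_all add: eq O_inf_ZpD(3) identity_off_transp\<close>)
  then show "chi_rep \<alpha> k m g Q T \<subseteq> chi_rep \<alpha> k m ?g' Q T" unfolding eq .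
qed

section \<open>Finite levels and representatives of double cosets\<close>

lemma finite_subset_idx_set_fin:
  assumes "finite J" "J \<subseteq> idx_set \<alpha> k"
  shows "\<exists>m. J \<subseteq> idx_set_fin \<alpha> k m"
proof -
  \<comment> \<open>Indices of the finite part count as coordinate 0; the successor below accounts
    for the strict bound in \<open>idx_set_fin\<close>.\<close>
  let ?f = "case_sum (\<lambda>_. 0) snd :: idx \<Rightarrow> nat"
  have "b \<in> idx_set_fin \<alpha> k (Suc (Max (?f ` J)))" if b: "b \<in> J" for b
  proof -
    have "?f b \<le> Max (?f ` J)" using assms(1) b by (intro Max_ge) auto
    then show ?thesis using b assms(2) by (cases b rule: idx_cases) auto
  qed
  then show ?thesis by blast
qed

text \<open>The finitely many exceptional entries fit into one level, so the description that
  defines \<open>chi\<close> has a candidate.\<close>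

lemma ex_bG_fin: "g \<in> carrier (bG \<alpha> k) \<Longrightarrow> \<exists>m. g \<in> bG_fin \<alpha> k m"
  using bG_finitary[unfolded finitary_iff] finite_subset_idx_set_fin identity_off_mono
  unfolding bG_fin_iff by meson

lemma finitary_nat_bound:
  assumes "finitary UNIV (u :: (nat, 'p :: prime_card) qmat)"
  shows "\<exists>m. identity_off UNIV {..<m} u"
proof -
  obtain J where "finite J" "identity_off UNIV J u" using assms unfolding finitary_iff by blast
  moreover obtain m where "J \<subseteq> {..<m}" using \<open>finite J\<close> finite_nat_iff_bounded by blast
  ultimately show ?thesis using identity_off_mono by blast
qed

lemma double_cosetE:
  assumes "\<gg> \<in> double_cosets \<alpha> k"
  obtains g where "g \<in> carrier (bG \<alpha> k)"
    "\<gg> = {mat_mul (mat_mul (frakI \<alpha> k u1) g) (frakI \<alpha> k u2) | u1 u2. u1 \<in> O_inf_Zp \<and> u2 \<in> O_inf_Zp}"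
proof -
  have mult: "x \<otimes>\<^bsub>bG \<alpha> k\<^esub> y = mat_mul x y" for x y
    by (simp add: bG_def GL_fin_def units_of_mult finitary_monoid_def)
  show ?thesis
    using assms that unfolding double_cosets_def r_coset_def set_mult_def bK_def mult by blast
qed

theorem theorem4p5:
  fixes \<alpha> k :: nat
    and \<gg> :: "(idx, 'p :: prime_card) qmat set"
    and Q T :: "(nat + nat \<Rightarrow> 'p qp) set"
  assumes "k \<ge> 1"
    and "\<gg> \<in> double_cosets \<alpha> k"
    and "self_dual (sympl_space k) (sympl_form k) Q"
    and "self_dual (sympl_space k) (sympl_form k) T"
  shows "chi \<alpha> k \<gg> Q T \<in> Naz_bar \<alpha>"
proof -
  note Q = self_dualD(1)[OF assms(3)] and T = self_dualD(1)[OF assms(4)]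
  obtain g where g: "g \<in> carrier (bG \<alpha> k)" and
    gg: "\<gg> = {mat_mul (mat_mul (frakI \<alpha> k u1) g) (frakI \<alpha> k u2) | u1 u2. u1 \<in> O_inf_Zp \<and> u2 \<in> O_inf_Zp}"
    using double_cosetE[OF assms(2)] .
  obtain m where m: "g \<in> bG_fin \<alpha> k m" using ex_bG_fin[OF g] ..
  have "mat_mul (mat_mul (frakI \<alpha> k (one_mat UNIV)) g) (frakI \<alpha> k (one_mat UNIV)) = g"
    unfolding frakI_one_mat by (simp add: mat_mul_one_left mat_mul_one_right bG_finitary[OF g])
  then have g_in: "g \<in> \<gg>" unfolding gg using one_mat_O_inf_Zp
    by (intro CollectI exI[of _ "one_mat UNIV"]) simp
  \<comment> \<open>Both representatives are compared at a common level \<open>n\<close> at which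
    \<open>u1\<close> and \<open>u2\<close> also live; there two-sided multiplication does not
    change the set.\<close>
  have indep: "chi_rep \<alpha> k m' g' Q T = chi_rep \<alpha> k m g Q T" if g': "g' \<in> \<gg> \<inter> bG_fin \<alpha> k m'" for m' g'
  proof -
    obtain u1 u2 where u: "u1 \<in> O_inf_Zp" "u2 \<in> O_inf_Zp"
      and eq: "g' = mat_mul (mat_mul (frakI \<alpha> k u1) g) (frakI \<alpha> k u2)"
      using g' unfolding gg by blast
    obtain m1 m2 where m12: "identity_off UNIV {..<m1} u1" "identity_off UNIV {..<m2} u2"
      using finitary_nat_bound O_inf_ZpD(1) u by meson
    define n where "n = Max {m, m', m1, m2}"
    have n: "m \<le> n" "m' \<le> n" "m1 \<le> n" "m2 \<le> n" unfolding n_def by auto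
    have off: "identity_off UNIV {..<n} u1" "identity_off UNIV {..<n} u2"
      using m12 n by (auto elim!: identity_off_mono)
    have "chi_rep \<alpha> k m' g' Q T = chi_rep \<alpha> k n g' Q T"
      by (rule chi_rep_mono_m[OF _ n(2) Q T]) (use g' in blast)
    also have "\<dots> = chi_rep \<alpha> k n g Q T"
      unfolding eq by (rule chi_rep_mult[OF g _ u(1) off(1) u(2) off(2) Q T])
        (use g' in \<open>auto simp: eq bG_fin_iff\<close>)
    also have "\<dots> = chi_rep \<alpha> k m g Q T"
      by (rule chi_rep_mono_m[OF m n(1) Q T, symmetric])
    finally show ?thesis .
  qed
  \<comment> \<open>Existence comes from \<open>g\<close> at level \<open>m\<close>, uniqueness from
    \<open>indep\<close>.\<close>
  have "chi \<alpha> k \<gg> Q T = chi_rep \<alpha> k m g Q T"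
    unfolding chi_def by (rule the_equality) (use g_in m indep in blast)+
  then show ?thesis using chi_rep_self_dual[OF m assms(3,4)] by simp
qed

end
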